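(* Let $\Lambda=\Lambda(\mathbb{F}_n)$ be the space of Schreier graphs of $\mathbb{F}_n=\langle a_1,\ldots,a_n\rangle$, let $\Omega$ be the space of connected rooted $2n$-regular graphs, and let $f:\Lambda\to\Omega$ be the forgetful map sending a Schreier graph to its underlying unlabeled, undirected rooted graph. Then the induced map $f:\mathcal{S}(\Lambda)\to\mathcal{S}(\Omega)$, $\nu\mapsto f_*\nu$, between the spaces of sofic measures is surjective.
   Context: Graphs may have loops and multiple edges; a loop contributes $2$ to the degree. $\Omega$ is the set of root-preserving isomorphism classes of connected rooted graphs $(\Gamma,x)$ in which every vertex has degree $2n$. A Schreier structure on a $2n$-regular graph is an orientation of its edges and a labeling of them with $a_1,\ldots,a_n$ so that every vertex has, for each $i$, precisely one incoming and one outgoing edge labeled $a_i$. A Schreier graph is a connected rooted $2n$-regular graph with a Schreier structure; $\Lambda$ is the set of isomorphism classes of Schreier graphs, isomorphisms preserving root, labels and orientations. Both $X=\Omega$ and $X=\Lambda$ carry the compact topology whose base is given by the cylinder sets $\{(\Gamma,x): U_r(x)\cong U\}$, where $U_r(x)$ is the $r$-neighborhood of the root (labeled in the case of $\Lambda$). A finite $2n$-regular graph $\Gamma$ (respectively a finite $2n$-regular graph endowed with a Schreier structure) determines a finitely supported unimodular probability measure on $\Omega$ (respectively $\Lambda$): choose a vertex $x$ of $\Gamma$ uniformly at random as the root, and take the isomorphism class of the connected component of $x$ rooted at $x$. A measure $\mu$ on $X$ is sofic if there is a sequence of such finite graphs $\{\Gamma_i\}_{i\in\mathbb{N}}$ such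 that $\mu_i\to\mu$ weakly, where $\mu_i$ is the measure on $X$ determined by $\Gamma_i$ (such a limit is automatically a unimodular probability measure). $\mathcal{S}(X)$ denotes the set of sofic measures on $X$. *)

theory Defs
  imports "HOL-Probability.Probability"
begin

section \<open>Multigraphs\<close>

text \<open>Edges are undirected; \<open>ends e\<close> is the set of endpoints, a singleton when \<open>e\<close> is a loop.\<close>

record ('v, 'e) multigraph =
  verts :: "'v set"
  edges :: "'e set"
  ends :: "'e \<Rightarrow> 'v set"

definition wf_multigraph :: "('v, 'e, 'z) multigraph_scheme \<Rightarrow> bool" where
  "wf_multigraph G \<longleftrightarrow>
     (\<forall>e\<in>edges G. \<exists>u\<in>verts G. \<exists>v\<in>verts G. ends G e = {u, v})"

definition degree :: "('v, 'e, 'z) multigraph_scheme \<Rightarrow> 'v \<Rightarrow> nat" where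
  "degree G v = card {e \<in> edges G. v \<in> ends G e} + card {e \<in> edges G. ends G e = {v}}"

text \<open>Finiteness of the set of incident edges is required separately because \<open>card\<close> is 0 on
  infinite sets.\<close>

definition regular :: "nat \<Rightarrow> ('v, 'e, 'z) multigraph_scheme \<Rightarrow> bool" where
  "regular d G \<longleftrightarrow>
     (\<forall>v\<in>verts G. finite {e \<in> edges G. v \<in> ends G e} \<and> degree G v = d)"

definition adj :: "('v, 'e, 'z) multigraph_scheme \<Rightarrow> ('v \<times> 'v) set" where
  "adj G = {(u, v). \<exists>e\<in>edges G. ends G e = {u, v}}"

definition connected_graph :: "('v, 'e, 'z) multigraph_scheme \<Rightarrow> bool" where
  "connected_graph G \<longleftrightarrow> (\<forall>u\<in>verts G. \<forall>v\<in>verts G. (u, v) \<in> (adj G)\<^sup>*)"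

definition induced ::
  "('v, 'e, 'z) multigraph_scheme \<Rightarrow> 'v set \<Rightarrow> ('v, 'e, 'z) multigraph_scheme" where
  "induced G W = G\<lparr>verts := W, edges := {e \<in> edges G. ends G e \<subseteq> W}\<rparr>"

definition component ::
  "('v, 'e, 'z) multigraph_scheme \<Rightarrow> 'v \<Rightarrow> ('v, 'e, 'z) multigraph_scheme" where
  "component G x = induced G {y \<in> verts G. (x, y) \<in> (adj G)\<^sup>*}"

text \<open>The \<open>r\<close>-neighborhood of \<open>x\<close>: the subgraph induced on the vertices at distance at most
  \<open>r\<close> from \<open>x\<close>.\<close>

definition nbhd ::
  "('v, 'e, 'z) multigraph_scheme \<Rightarrow> 'v \<Rightarrow> nat \<Rightarrow> ('v, 'e, 'z) multigraph_scheme" where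
  "nbhd G x r = induced G {y \<in> verts G. \<exists>k\<le>r. (x, y) \<in> adj G ^^ k}"

definition rooted_iso ::
  "('v, 'e) multigraph \<times> 'v \<Rightarrow> ('w, 'f) multigraph \<times> 'w \<Rightarrow> bool" where
  "rooted_iso = (\<lambda>(G, x) (H, y). \<exists>\<phi> \<psi>.
     bij_betw \<phi> (verts G) (verts H) \<and> bij_betw \<psi> (edges G) (edges H) \<and>
     (\<forall>e\<in>edges G. ends H (\<psi> e) = \<phi> ` ends G e) \<and> \<phi> x = y)"


section \<open>Schreier structures\<close>

text \<open>An edge \<open>e\<close> is directed from \<open>source e\<close> to \<open>target e\<close> and has label \<open>a\<^sub>i\<close>, where
  \<open>i = gen e\<close>.\<close>

record ('v, 'e) schreier = "('v, 'e) multigraph" +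
  source :: "'e \<Rightarrow> 'v"
  target :: "'e \<Rightarrow> 'v"
  gen :: "'e \<Rightarrow> nat"

definition schreier_structure :: "nat \<Rightarrow> ('v, 'e) schreier \<Rightarrow> bool" where
  "schreier_structure n G \<longleftrightarrow>
     (\<forall>e\<in>edges G. ends G e = {source G e, target G e} \<and> gen G e \<in> {1..n}) \<and>
     (\<forall>v\<in>verts G. \<forall>i\<in>{1..n}.
        (\<exists>!e. e \<in> edges G \<and> gen G e = i \<and> target G e = v) \<and>
        (\<exists>!e. e \<in> edges G \<and> gen G e = i \<and> source G e = v))"

definition schreier_iso ::
  "('v, 'e) schreier \<times> 'v \<Rightarrow> ('w, 'f) schreier \<times> 'w \<Rightarrow> bool" where
  "schreier_iso = (\<lambda>(G, x) (H, y). \<exists>\<phi> \<psi>.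
     bij_betw \<phi> (verts G) (verts H) \<and> bij_betw \<psi> (edges G) (edges H) \<and>
     (\<forall>e\<in>edges G. ends H (\<psi> e) = \<phi> ` ends G e \<and>
        source H (\<psi> e) = \<phi> (source G e) \<and> target H (\<psi> e) = \<phi> (target G e) \<and>
        gen H (\<psi> e) = gen G e) \<and> \<phi> x = y)"


section \<open>The spaces of rooted graphs\<close>

text \<open>A connected \<open>2n\<close>-regular graph has countably many vertices and edges, so every isomorphism
  class is represented by a graph whose vertices and edges are natural numbers.\<close>

type_synonym rooted_graph = "(nat, nat) multigraph \<times> nat"
type_synonym rooted_schreier = "(nat, nat) schreier \<times> nat"

definition rooted_graphs :: "nat \<Rightarrow> rooted_graph set" where
  "rooted_graphs n = {(G, x). wf_multigraph G \<and> regular (2 * n) G \<and> connected_graph G \<and>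
     x \<in> verts G}"

definition schreier_graphs :: "nat \<Rightarrow> rooted_schreier set" where
  "schreier_graphs n = {(G, x). wf_multigraph G \<and> regular (2 * n) G \<and> connected_graph G \<and>
     schreier_structure n G \<and> x \<in> verts G}"

definition Omega_rel :: "nat \<Rightarrow> (rooted_graph \<times> rooted_graph) set" where
  "Omega_rel n = {(p, q). p \<in> rooted_graphs n \<and> q \<in> rooted_graphs n \<and> rooted_iso p q}"

definition Lambda_rel :: "nat \<Rightarrow> (rooted_schreier \<times> rooted_schreier) set" where
  "Lambda_rel n = {(p, q). p \<in> schreier_graphs n \<and> q \<in> schreier_graphs n \<and> schreier_iso p q}"

definition Omega :: "nat \<Rightarrow> rooted_graph set set" where
  "Omega n = rooted_graphs n // Omega_rel n"

definition Lambda :: "nat \<Rightarrow> rooted_schreier set set" where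
  "Lambda n = schreier_graphs n // Lambda_rel n"

definition Omega_cylinder :: "nat \<Rightarrow> nat \<Rightarrow> rooted_graph \<Rightarrow> rooted_graph set set" where
  "Omega_cylinder n r U = {A \<in> Omega n. \<exists>(G, x)\<in>A. rooted_iso (nbhd G x r, x) U}"

definition Lambda_cylinder :: "nat \<Rightarrow> nat \<Rightarrow> rooted_schreier \<Rightarrow> rooted_schreier set set" where
  "Lambda_cylinder n r U = {A \<in> Lambda n. \<exists>(G, x)\<in>A. schreier_iso (nbhd G x r, x) U}"

definition Omega_top :: "nat \<Rightarrow> rooted_graph set topology" where
  "Omega_top n = topology_generated_by {Omega_cylinder n r U | r U. True}"

definition Lambda_top :: "nat \<Rightarrow> rooted_schreier set topology" where
  "Lambda_top n = topology_generated_by {Lambda_cylinder n r U | r U. True}"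

text \<open>The forgetful map, as a map on isomorphism classes.\<close>

definition forget :: "nat \<Rightarrow> rooted_schreier set \<Rightarrow> rooted_graph set" where
  "forget n A = (\<Union>(G, x)\<in>A. Omega_rel n `` {(multigraph.truncate G, x)})"


section \<open>Sofic measures\<close>

definition borel_of_top :: "'a topology \<Rightarrow> 'a measure" where
  "borel_of_top T = sigma (topspace T) {S. openin T S}"

definition converges_weakly ::
  "'a topology \<Rightarrow> (nat \<Rightarrow> 'a measure) \<Rightarrow> 'a measure \<Rightarrow> bool" where
  "converges_weakly T M N \<longleftrightarrow>
     (\<forall>g. continuous_map T euclideanreal g \<and> bounded (g ` topspace T) \<longrightarrow>
        (\<lambda>i. \<integral>x. g x \<partial>M i) \<longlonglongrightarrow> (\<integral>x. g x \<partial>N))"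

definition finite_regular_graph :: "nat \<Rightarrow> (nat, nat, 'z) multigraph_scheme \<Rightarrow> bool" where
  "finite_regular_graph n G \<longleftrightarrow>
     wf_multigraph G \<and> finite (verts G) \<and> verts G \<noteq> {} \<and> regular (2 * n) G"

definition Omega_measure :: "nat \<Rightarrow> (nat, nat) multigraph \<Rightarrow> rooted_graph set measure" where
  "Omega_measure n G = distr (uniform_count_measure (verts G)) (borel_of_top (Omega_top n))
     (\<lambda>x. Omega_rel n `` {(component G x, x)})"

definition Lambda_measure :: "nat \<Rightarrow> (nat, nat) schreier \<Rightarrow> rooted_schreier set measure" where
  "Lambda_measure n G = distr (uniform_count_measure (verts G)) (borel_of_top (Lambda_top n))
     (\<lambda>x. Lambda_rel n `` {(component G x, x)})"

definition sofic_Omega :: "nat \<Rightarrow> rooted_graph set measure set" where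
  "sofic_Omega n = {\<mu>. sets \<mu> = sets (borel_of_top (Omega_top n)) \<and> prob_space \<mu> \<and>
     (\<exists>\<Gamma>. (\<forall>i. finite_regular_graph n (\<Gamma> i)) \<and>
       converges_weakly (Omega_top n) (\<lambda>i. Omega_measure n (\<Gamma> i)) \<mu>)}"

definition sofic_Lambda :: "nat \<Rightarrow> rooted_schreier set measure set" where
  "sofic_Lambda n = {\<nu>. sets \<nu> = sets (borel_of_top (Lambda_top n)) \<and> prob_space \<nu> \<and>
     (\<exists>\<Gamma>. (\<forall>i. finite_regular_graph n (\<Gamma> i) \<and> schreier_structure n (\<Gamma> i)) \<and>
       converges_weakly (Lambda_top n) (\<lambda>i. Lambda_measure n (\<Gamma> i)) \<nu>)}"

definition forget_push :: "nat \<Rightarrow> rooted_schreier set measure \<Rightarrow> rooted_graph set measure" where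
  "forget_push n \<nu> = distr \<nu> (borel_of_top (Omega_top n)) (forget n)"

end

theory Submission
  imports Defs
begin

text \<open>
The image of a sofic measure under the forgetful map is sofic because the map is continuous and
commutes with taking random rootings of finite graphs. For surjectivity, let \<open>\<mu>\<close> be a weak limit of the
measures given by finite \<open>2n\<close>-regular graphs. Two facts carry the proof.

First, every finite \<open>2n\<close>-regular multigraph has a Schreier structure
(\<open>finite_regular_graph_has_schreier_structure\<close>, essentially Petersen's theorem): all degrees are even, so
the edges can be oriented with \<open>n\<close> edges entering and \<open>n\<close> edges leaving every vertex
(\<open>balanced_orientation\<close>), and the \<open>n\<close>-regular bipartite graph between sources and targets splits into \<open>n\<close>
perfect matchings by Hall's theorem (\<open>regular_bipartite_factorization\<close>). Hence every measure in the
approximating sequence lifts to a measure on the space of Schreier graphs.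

Second, the space of Schreier graphs is compact (\<open>compact_space_Lambda\<close>). A Schreier graph is determined by the
equivalence relation "two words lead from the root to the same vertex", the possible relations form
a closed subset of a product of two-point spaces, and neighborhoods of the root depend on finitely many
coordinates. Since clopen cylinders form a countable base, the sequence of lifted measures has a
weakly convergent subsequence (\<open>weakly_convergent_subsequence\<close>).

The limit of that subsequence is sofic and, by continuity of the forgetful map (\<open>continuous_forget\<close>),
its image is a weak limit of a subsequence of the original measures. Weak limits are unique
(\<open>weak_limit_unique\<close>) because probability measures are determined by their values on clopen
sets; so the image is \<open>\<mu>\<close>.
\<close>

section \<open>Hall's theorem and factorizations of regular bipartite multigraphs\<close>

text \<open>Rado's argument. If some \<open>A i\<close> contains two distinct elements \<open>x\<close> and \<open>y\<close>, one of them can be deleted from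
it without destroying the marriage condition: two violating index sets, one for each deletion,
would contradict the condition for their union and their intersection. Repeating
this leaves singletons, and singletons that satisfy the condition are pairwise distinct.\<close>

lemma hall_marriage:
  fixes A :: "'i \<Rightarrow> 'a set"
  assumes "finite I" and "\<And>i. i \<in> I \<Longrightarrow> finite (A i)"
    and "\<And>J. J \<subseteq> I \<Longrightarrow> card J \<le> card (\<Union>(A ` J))"
  shows "\<exists>f. inj_on f I \<and> (\<forall>i\<in>I. f i \<in> A i)"
  using assms(2,3)
proof (induction "\<Sum>i\<in>I. card (A i)" arbitrary: A rule: less_induct)
  case less
  note fin = \<open>finite I\<close> less.prems(1) and hall = less.prems(2)
  have finJ: "finite J" if "J \<subseteq> I" for J
    using that fin(1) by (rule finite_subset)
  have finU: "finite (\<Union>(A ` J))" if "J \<subseteq> I" for J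
    using that fin finJ by blast
  show ?case
  proof (cases "\<exists>i\<in>I. \<exists>x\<in>A i. \<exists>y\<in>A i. x \<noteq> y")
    case True
    then obtain i x y where i: "i \<in> I" and xy: "x \<in> A i" "y \<in> A i" "x \<noteq> y" by blast
    define B where "B z = A(i := A i - {z})" for z
    \<comment> \<open>Submodularity: \<open>U1 \<union> U2\<close> recovers all of \<open>A i\<close> because \<open>x \<noteq> y\<close>.\<close>
    have "(\<forall>J\<subseteq>I. card J \<le> card (\<Union>(B x ` J))) \<or> (\<forall>J\<subseteq>I. card J \<le> card (\<Union>(B y ` J)))"
    proof (rule ccontr)
      assume "\<not> ?thesis"
      then obtain J1 J2 where J: "J1 \<subseteq> I" "J2 \<subseteq> I"
        and lt: "card (\<Union>(B x ` J1)) < card J1" "card (\<Union>(B y ` J2)) < card J2"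
        by (auto simp: not_le)
      have untouched: "\<Union>(B z ` J) = \<Union>(A ` J)" if "i \<notin> J" for z J
        using that by (auto simp: B_def)
      have iJ: "i \<in> J1" "i \<in> J2"
        using lt hall J by (metis untouched not_le)+
      define K1 K2 where "K1 = J1 - {i}" and "K2 = J2 - {i}"
      define U1 U2 where "U1 = \<Union>(A ` K1) \<union> (A i - {x})" and "U2 = \<Union>(A ` K2) \<union> (A i - {y})"
      have U: "\<Union>(B x ` J1) = U1" "\<Union>(B y ` J2) = U2"
        using iJ by (auto simp: U1_def U2_def K1_def K2_def B_def split: if_splits)
      have K: "K1 \<subseteq> I" "K2 \<subseteq> I" "i \<notin> K1 \<union> K2" using J by (auto simp: K1_def K2_def)
      have cK: "card J1 = Suc (card K1)" "card J2 = Suc (card K2)"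
        using card.remove[OF finJ[OF J(1)] iJ(1)] card.remove[OF finJ[OF J(2)] iJ(2)]
        by (simp_all only: K1_def K2_def)
      have finU12: "finite U1" "finite U2"
        using finU K fin i by (auto simp: U1_def U2_def)
      have "card U1 + card U2 = card (U1 \<union> U2) + card (U1 \<inter> U2)"
        using finU12 by (rule card_Un_Int)
      moreover have "card (U1 \<union> U2) \<ge> Suc (card (K1 \<union> K2))"
      proof -
        have "U1 \<union> U2 = \<Union>(A ` insert i (K1 \<union> K2))"
          using xy by (auto simp: U1_def U2_def)
        then show ?thesis
          using hall[of "insert i (K1 \<union> K2)"] K i finJ by auto
      qed
      moreover have "card (U1 \<inter> U2) \<ge> card (K1 \<inter> K2)"
      proof -
        have "card (K1 \<inter> K2) \<le> card (\<Union>(A ` (K1 \<inter> K2)))" using K by (intro hall) auto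
        also have "\<dots> \<le> card (U1 \<inter> U2)"
          using finU12 by (intro card_mono) (auto simp: U1_def U2_def)
        finally show ?thesis .
      qed
      moreover have "card (K1 \<union> K2) + card (K1 \<inter> K2) = card K1 + card K2"
        using card_Un_Int[of K1 K2] K finJ by simp
      ultimately show False using lt cK unfolding U by linarith
    qed
    then obtain z where z: "z \<in> A i" and hB: "\<And>J. J \<subseteq> I \<Longrightarrow> card J \<le> card (\<Union>(B z ` J))"
      using xy by blast
    have "(\<Sum>j\<in>I. card (B z j)) < (\<Sum>j\<in>I. card (A j))"
    proof (rule sum_strict_mono_ex1)
      show "\<forall>j\<in>I. card (B z j) \<le> card (A j)"
        using fin by (auto simp: B_def intro: card_mono)
      show "\<exists>j\<in>I. card (B z j) < card (A j)"
        using card_Diff1_less[OF fin(2)[OF i] z] i by (intro bexI[of _ i]) (auto simp: B_def)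
    qed (use fin in auto)
    moreover have "finite (B z j)" if "j \<in> I" for j using fin that by (auto simp: B_def)
    ultimately obtain f where "inj_on f I" "\<forall>j\<in>I. f j \<in> B z j"
      using less.hyps[of "B z"] hB by blast
    then show ?thesis by (intro exI[of _ f]) (auto simp: B_def split: if_splits)
  next
    case False
    have ne: "\<exists>x. x \<in> A i" if "i \<in> I" for i
      using hall[of "{i}"] that by (cases "A i = {}") auto
    define f where "f i = (SOME x. x \<in> A i)" for i
    have f: "f i \<in> A i" if "i \<in> I" for i
      unfolding f_def using someI_ex[OF ne[OF that]] .
    have A: "A i = {f i}" if "i \<in> I" for i using f[OF that] False that by blast
    have "inj_on f I"
    proof (rule inj_onI, rule ccontr)
      fix i j assume ij: "i \<in> I" "j \<in> I" "f i = f j" "i \<noteq> j"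
      then show False using hall[of "{i, j}"] A by simp
    qed
    then show ?thesis using f by blast
  qed
qed

lemma card_fibres:
  assumes "finite E" "finite J"
  shows "card {e \<in> E. f e \<in> J} = (\<Sum>v\<in>J. card {e \<in> E. f e = v})"
proof -
  have "{e \<in> E. f e \<in> J} = (\<Union>v\<in>J. {e \<in> E. f e = v})" by auto
  moreover have "card (\<Union>v\<in>J. {e \<in> E. f e = v}) = (\<Sum>v\<in>J. card {e \<in> E. f e = v})"
    using assms by (intro card_UN_disjoint) auto
  ultimately show ?thesis by simp
qed

text \<open>The bipartite multigraph has one edge from \<open>s e \<in> A\<close> to \<open>t e \<in> B\<close> for each \<open>e \<in> E\<close>. The \<open>n * card J\<close> edges
that leave \<open>J\<close> all enter the neighbors of \<open>J\<close>, each of which receives only \<open>n\<close> edges; hence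
Hall's condition holds. Counting all edges gives \<open>card A = card B\<close>, so that the matching is perfect.\<close>

lemma regular_bipartite_perfect_matching:
  fixes s :: "'e \<Rightarrow> 'a" and t :: "'e \<Rightarrow> 'b"
  assumes fin: "finite A" "finite B" "finite E" and n: "n > 0"
    and st: "\<And>e. e \<in> E \<Longrightarrow> s e \<in> A \<and> t e \<in> B"
    and regA: "\<And>v. v \<in> A \<Longrightarrow> card {e \<in> E. s e = v} = n"
    and regB: "\<And>v. v \<in> B \<Longrightarrow> card {e \<in> E. t e = v} = n"
  shows "\<exists>M\<subseteq>E. bij_betw s M A \<and> bij_betw t M B"
proof -
  define N where "N v = t ` {e \<in> E. s e = v}" for v
  have N: "N v \<subseteq> B" for v using st by (auto simp: N_def)
  have hall: "card J \<le> card (\<Union>(N ` J))" if J: "J \<subseteq> A" for J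
  proof -
    have finJ: "finite J" "finite (\<Union>(N ` J))"
      using J fin N by (auto intro: finite_subset)
    have "n * card J = card {e \<in> E. s e \<in> J}"
      using card_fibres[OF fin(3) finJ(1), of s] J regA by (simp add: subset_iff)
    also have "\<dots> \<le> card {e \<in> E. t e \<in> \<Union>(N ` J)}"
      using fin by (intro card_mono) (auto simp: N_def)
    also have "\<dots> = (\<Sum>v\<in>\<Union>(N ` J). card {e \<in> E. t e = v})" by (rule card_fibres[OF fin(3) finJ(2)])
    also have "\<dots> = (\<Sum>v\<in>\<Union>(N ` J). n)" using N regB by (intro sum.cong) auto
    also have "\<dots> = n * card (\<Union>(N ` J))" by simp
    finally show ?thesis using n by simp
  qed
  obtain f where f: "inj_on f A" "\<And>v. v \<in> A \<Longrightarrow> f v \<in> N v"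
    using hall_marriage[of A N] hall fin N by (metis finite_subset)
  have "card E = card {e \<in> E. s e \<in> A}" using st by (intro arg_cong[where f = card]) auto
  also have "\<dots> = (\<Sum>v\<in>A. n)"
    unfolding card_fibres[OF fin(3,1)] by (intro sum.cong refl regA)
  finally have cardA: "card E = n * card A" by simp
  have "card E = card {e \<in> E. t e \<in> B}" using st by (intro arg_cong[where f = card]) auto
  also have "\<dots> = (\<Sum>v\<in>B. n)"
    unfolding card_fibres[OF fin(3,2)] by (intro sum.cong refl regB)
  finally have "card A = card B" using cardA n by simp
  moreover have "f ` A \<subseteq> B" using f(2) N by blast
  ultimately have fB: "f ` A = B" using fin f(1) by (metis card_image card_subset_eq)
  have "\<forall>v\<in>A. \<exists>e\<in>E. s e = v \<and> t e = f v" using f(2) by (fastforce simp: N_def)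
  then obtain m where m: "\<And>v. v \<in> A \<Longrightarrow> m v \<in> E \<and> s (m v) = v \<and> t (m v) = f v" by metis
  have "bij_betw s (m ` A) A"
    using m by (intro bij_betwI[where g = m]) auto
  moreover have "bij_betw t (m ` A) B"
    unfolding bij_betw_def
  proof
    show "inj_on t (m ` A)" using m f(1) by (auto simp: inj_on_def)
    show "t ` m ` A = B" using m fB by (force simp: image_iff)
  qed
  moreover have "m ` A \<subseteq> E" using m by auto
  ultimately show ?thesis by blast
qed

lemma card_fibre_matching:
  assumes "M \<subseteq> E" "finite E" "bij_betw f M A" "v \<in> A"
  shows "card {e \<in> E - M. f e = v} = card {e \<in> E. f e = v} - 1"
proof -
  obtain m where m: "m \<in> M" "f m = v" "\<And>e. e \<in> M \<Longrightarrow> f e = v \<Longrightarrow> e = m"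
    using assms(3,4) by (metis bij_betw_imp_inj_on bij_betw_imp_surj_on imageE inj_onD)
  have "{e \<in> E - M. f e = v} = {e \<in> E. f e = v} - {m}" using m by blast
  moreover have "m \<in> {e \<in> E. f e = v}" using m(1,2) assms(1) by auto
  ultimately show ?thesis by (simp add: card_Diff_singleton)
qed

text \<open>Koenig's factorization: removing a perfect matching lowers the degree by one, so the
edges split into \<open>n\<close> matchings, and \<open>g\<close> records which matching an edge belongs to.\<close>

lemma regular_bipartite_factorization:
  fixes s :: "'e \<Rightarrow> 'a" and t :: "'e \<Rightarrow> 'b"
  assumes "finite A" "finite B" "finite E"
    and "\<And>e. e \<in> E \<Longrightarrow> s e \<in> A \<and> t e \<in> B"
    and "\<And>v. v \<in> A \<Longrightarrow> card {e \<in> E. s e = v} = n"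
    and "\<And>v. v \<in> B \<Longrightarrow> card {e \<in> E. t e = v} = n"
  shows "\<exists>g. g ` E \<subseteq> {1..n} \<and>
    (\<forall>i\<in>{1..n}. bij_betw s {e \<in> E. g e = i} A \<and> bij_betw t {e \<in> E. g e = i} B)"
  using assms(3-)
proof (induction n arbitrary: E)
  case 0
  have "e \<notin> E" for e
  proof
    assume "e \<in> E"
    then have "e \<in> {e' \<in> E. s e' = s e}" "finite {e' \<in> E. s e' = s e}" "s e \<in> A"
      using 0 by auto
    then show False using 0(3)[of "s e"] by auto
  qed
  then have "E = {}" by blast
  then show ?case by simp
next
  case (Suc n)
  then obtain M where M: "M \<subseteq> E" "bij_betw s M A" "bij_betw t M B"
    using regular_bipartite_perfect_matching[OF assms(1,2), of E "Suc n" s t] by auto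
  have "\<exists>g. g ` (E - M) \<subseteq> {1..n} \<and> (\<forall>i\<in>{1..n}. bij_betw s {e \<in> E - M. g e = i} A \<and>
      bij_betw t {e \<in> E - M. g e = i} B)"
  proof (rule Suc.IH)
    show "card {e \<in> E - M. s e = v} = n" if "v \<in> A" for v
      using card_fibre_matching[OF M(1) Suc.prems(1) M(2) that] Suc.prems(3)[OF that] by simp
    show "card {e \<in> E - M. t e = v} = n" if "v \<in> B" for v
      using card_fibre_matching[OF M(1) Suc.prems(1) M(3) that] Suc.prems(4)[OF that] by simp
  qed (use Suc.prems in auto)
  then obtain g where g: "g ` (E - M) \<subseteq> {1..n}"
    "\<And>i. i \<in> {1..n} \<Longrightarrow> bij_betw s {e \<in> E - M. g e = i} A \<and> bij_betw t {e \<in> E - M. g e = i} B"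
    by blast
  define h where "h e = (if e \<in> M then Suc n else g e)" for e
  have old: "{e \<in> E. h e = i} = {e \<in> E - M. g e = i}" if "i \<in> {1..n}" for i
    using that M by (auto simp: h_def)
  have new: "{e \<in> E. h e = Suc n} = M"
  proof -
    have "h e \<noteq> Suc n" if "e \<in> E - M" for e
    proof -
      have "g e \<in> {1..n}" using g(1) that by blast
      then show ?thesis using that by (simp add: h_def)
    qed
    then show ?thesis using M(1) by (auto simp: h_def)
  qed
  have "h e \<in> {1..Suc n}" if "e \<in> E" for e
  proof (cases "e \<in> M")
    case False
    then have "g e \<in> {1..n}" using g(1) that by blast
    then show ?thesis using False by (simp add: h_def)
  qed (simp add: h_def)
  then have "h ` E \<subseteq> {1..Suc n}" by blast
  moreover have "bij_betw s {e \<in> E. h e = i} A \<and> bij_betw t {e \<in> E. h e = i} B"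
    if "i \<in> {1..Suc n}" for i
  proof (cases "i = Suc n")
    case False
    then show ?thesis using that g(2) old by auto
  qed (use M new in auto)
  ultimately show ?case by blast
qed

section \<open>Balanced orientations\<close>

text \<open>The endpoints of \<open>e\<close> are \<open>s e\<close> and \<open>t e\<close>, and \<open>s'\<close>, \<open>t'\<close> orient \<open>e\<close> one way or the other. Two edges \<open>uv\<close> and
\<open>vw\<close> that meet in \<open>v\<close> can be replaced by a single edge \<open>uw\<close>: an orientation of that edge, read
as a directed path through \<open>v\<close>, contributes nothing to the balance at \<open>v\<close> and the same as before at \<open>u\<close> and
\<open>w\<close>. Once no two edges meet, every vertex meets at most one edge and any orientation will do.\<close>

lemma balanced_orientation:
  fixes s t :: "'e \<Rightarrow> 'v"
  assumes "finite E"
  shows "\<exists>s' t'. (\<forall>e\<in>E. s' e = s e \<and> t' e = t e \<or> s' e = t e \<and> t' e = s e) \<and>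
    (\<forall>v. \<bar>\<Sum>e\<in>E. of_bool (s' e = v) - of_bool (t' e = v)\<bar> \<le> (1::int))"
  using assms
proof (induction "card E" arbitrary: E s t rule: less_induct)
  case less
  show ?case
  proof (cases "\<exists>e1\<in>E. \<exists>e2\<in>E. e1 \<noteq> e2 \<and> {s e1, t e1} \<inter> {s e2, t e2} \<noteq> {}")
    case True
    then obtain e1 e2 v where e: "e1 \<in> E" "e2 \<in> E" "e1 \<noteq> e2"
      and v: "v \<in> {s e1, t e1}" "v \<in> {s e2, t e2}" by blast
    define u where "u = (if s e1 = v then t e1 else s e1)"
    have u: "s e1 = u \<and> t e1 = v \<or> s e1 = v \<and> t e1 = u"
      using v(1) by (auto simp: u_def)
    define w where "w = (if s e2 = v then t e2 else s e2)"
    have w: "s e2 = w \<and> t e2 = v \<or> s e2 = v \<and> t e2 = w"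
      using v(2) by (auto simp: w_def)
    \<comment> \<open>The edge \<open>e1\<close> takes over the role of the merged edge \<open>uw\<close>, and \<open>e2\<close> disappears.\<close>
    have "card (E - {e2}) < card E" using less.prems e(2) by (rule card_Diff1_less)
    from less.hyps[OF this finite_Diff[OF less.prems], of "s(e1 := u)" "t(e1 := w)"]
    obtain s' t' where
      st: "\<And>e. e \<in> E - {e2} \<Longrightarrow> s' e = (s(e1 := u)) e \<and> t' e = (t(e1 := w)) e \<or>
        s' e = (t(e1 := w)) e \<and> t' e = (s(e1 := u)) e"
      and bal: "\<And>x. \<bar>\<Sum>e\<in>E - {e2}. of_bool (s' e = x) - of_bool (t' e = x)\<bar> \<le> (1::int)"
      by blast
    define s'' where "s'' = (if s' e1 = u \<and> t' e1 = w then s'(e1 := u, e2 := v) else s'(e1 := v, e2 := w))"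
    define t'' where "t'' = (if s' e1 = u \<and> t' e1 = w then t'(e1 := v, e2 := w) else t'(e1 := u, e2 := v))"
    have e1: "s' e1 = u \<and> t' e1 = w \<or> s' e1 = w \<and> t' e1 = u" using st[of e1] e by auto
    have sums: "(\<Sum>e\<in>E. of_bool (s'' e = x) - of_bool (t'' e = x)) =
        (\<Sum>e\<in>E - {e2}. of_bool (s' e = x) - of_bool (t' e = x) :: int)" for x
    proof -
      have split: "(\<Sum>e\<in>E. h e) = h e2 + (h e1 + (\<Sum>e\<in>E - {e2} - {e1}. h e))" for h :: "'e \<Rightarrow> int"
        using e less.prems by (simp add: sum.remove[of _ e2] sum.remove[of _ e1])
      have split': "(\<Sum>e\<in>E - {e2}. h e) = h e1 + (\<Sum>e\<in>E - {e2} - {e1}. h e)" for h :: "'e \<Rightarrow> int"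
        using e less.prems by (simp add: sum.remove[of _ e1])
      have "(\<Sum>e\<in>E - {e2} - {e1}. of_bool (s'' e = x) - of_bool (t'' e = x)) =
          (\<Sum>e\<in>E - {e2} - {e1}. of_bool (s' e = x) - of_bool (t' e = x) :: int)"
        by (intro sum.cong) (auto simp: s''_def t''_def)
      then show ?thesis
        unfolding split split' using e1 e(3) by (auto simp: s''_def t''_def)
    qed
    have "s'' e = s e \<and> t'' e = t e \<or> s'' e = t e \<and> t'' e = s e" if "e \<in> E" for e
    proof -
      consider "e = e1" | "e = e2" | "e \<noteq> e1" "e \<noteq> e2" by blast
      then show ?thesis
      proof cases
        case 1
        then have "s'' e = u \<and> t'' e = v \<or> s'' e = v \<and> t'' e = u"
          using e(3) by (simp add: s''_def t''_def)
        with 1 u show ?thesis by metis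
      next
        case 2
        then have "s'' e = v \<and> t'' e = w \<or> s'' e = w \<and> t'' e = v"
          by (simp add: s''_def t''_def)
        with 2 w show ?thesis by metis
      next
        case 3
        then show ?thesis using st[of e] that by (simp add: s''_def t''_def)
      qed
    qed
    moreover have "\<bar>\<Sum>e\<in>E. of_bool (s'' e = x) - of_bool (t'' e = x)\<bar> \<le> (1::int)" for x
      unfolding sums by (rule bal)
    ultimately show ?thesis by blast
  next
    case False
    have "\<bar>\<Sum>e\<in>E. of_bool (s e = v) - of_bool (t e = v)\<bar> \<le> (1::int)" for v
    proof (cases "\<exists>e\<in>E. v \<in> {s e, t e}")
      case True
      then obtain e where e: "e \<in> E" "v \<in> {s e, t e}" by blast
      have "(\<Sum>e\<in>E. of_bool (s e = v) - of_bool (t e = v)) =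
          of_bool (s e = v) - of_bool (t e = v) +
          (\<Sum>e\<in>E - {e}. of_bool (s e = v) - of_bool (t e = v) :: int)"
        using e less.prems by (simp add: sum.remove)
      also have "(\<Sum>e\<in>E - {e}. of_bool (s e = v) - of_bool (t e = v) :: int) = 0"
        using e False by (intro sum.neutral) auto
      finally show ?thesis by auto
    next
      case False
      then have "(\<Sum>e\<in>E. of_bool (s e = v) - of_bool (t e = v)) = (0::int)"
        by (intro sum.neutral) auto
      then show ?thesis by simp
    qed
    then show ?thesis by (intro exI[of _ s] exI[of _ t]) auto
  qed
qed

section \<open>Schreier structures on finite regular graphs\<close>

lemma wf_ends_subset:
  "wf_multigraph G \<Longrightarrow> e \<in> edges G \<Longrightarrow> ends G e \<subseteq> verts G \<and> ends G e \<noteq> {} \<and> finite (ends G e)"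
  by (fastforce simp: wf_multigraph_def)

lemma finite_edges:
  assumes "wf_multigraph G" "regular d G" "finite (verts G)"
  shows "finite (edges G)"
proof -
  have "edges G \<subseteq> (\<Union>v\<in>verts G. {e \<in> edges G. v \<in> ends G e})"
    using assms(1) by (fastforce simp: wf_multigraph_def)
  moreover have "finite \<dots>" using assms by (auto simp: regular_def)
  ultimately show ?thesis by (rule finite_subset)
qed

text \<open>Loops are counted twice by the degree, once as outgoing and once as incoming edges.\<close>

lemma degree_eq_out_plus_in:
  assumes "finite {e \<in> edges G. v \<in> ends G e}"
    and st: "\<And>e. e \<in> edges G \<Longrightarrow> ends G e = {s e, t e}"
  shows "degree G v = card {e \<in> edges G. s e = v} + card {e \<in> edges G. t e = v}"
proof -
  have eq: "{e \<in> edges G. v \<in> ends G e} = {e \<in> edges G. s e = v} \<union> {e \<in> edges G. t e = v}"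
    "{e \<in> edges G. ends G e = {v}} = {e \<in> edges G. s e = v} \<inter> {e \<in> edges G. t e = v}"
    using st by auto
  show ?thesis
    using assms(1) unfolding degree_def eq by (subst card_Un_Int) auto
qed

text \<open>Out-degree and in-degree differ by at most one and have the even sum \<open>2 * n\<close>; so both are \<open>n\<close>.\<close>

lemma eulerian_orientation:
  assumes wf: "wf_multigraph G" and reg: "regular (2 * n) G" and fin: "finite (verts G)"
  obtains s t where "\<And>e. e \<in> edges G \<Longrightarrow> ends G e = {s e, t e}"
    and "\<And>v. v \<in> verts G \<Longrightarrow> card {e \<in> edges G. s e = v} = n"
    and "\<And>v. v \<in> verts G \<Longrightarrow> card {e \<in> edges G. t e = v} = n"
proof -
  have "\<forall>e\<in>edges G. \<exists>p. ends G e = {fst p, snd p}"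
    using wf by (fastforce simp: wf_multigraph_def)
  then obtain p where p: "\<And>e. e \<in> edges G \<Longrightarrow> ends G e = {fst (p e), snd (p e)}" by metis
  have finE: "finite (edges G)" using finite_edges[OF wf reg fin] .
  obtain s t where st: "\<And>e. e \<in> edges G \<Longrightarrow>
      s e = fst (p e) \<and> t e = snd (p e) \<or> s e = snd (p e) \<and> t e = fst (p e)"
    and bal: "\<And>v. \<bar>\<Sum>e\<in>edges G. of_bool (s e = v) - of_bool (t e = v)\<bar> \<le> (1::int)"
    using balanced_orientation[OF finE, of "\<lambda>e. fst (p e)" "\<lambda>e. snd (p e)"] by blast
  have ends: "ends G e = {s e, t e}" if "e \<in> edges G" for e
    using p[OF that] st[OF that] by auto
  have "card {e \<in> edges G. s e = v} = n \<and> card {e \<in> edges G. t e = v} = n" if v: "v \<in> verts G" for v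
  proof -
    let ?o = "card {e \<in> edges G. s e = v}" and ?i = "card {e \<in> edges G. t e = v}"
    have "?o + ?i = 2 * n"
      using degree_eq_out_plus_in[of G v s t] ends reg v by (auto simp: regular_def)
    moreover have "\<bar>int ?o - int ?i\<bar> \<le> 1"
      using bal[of v] finE by (simp add: sum_subtractf of_bool_def sum.If_cases Int_def)
    ultimately show ?thesis by presburger
  qed
  then show ?thesis using ends that by blast
qed

text \<open>Petersen's theorem. An Eulerian orientation turns the graph into an \<open>n\<close>-regular bipartite multigraph
between two copies of the vertex set (sources and targets), and its \<open>n\<close> perfect matchings are the
\<open>n\<close> labels.\<close>

theorem finite_regular_graph_has_schreier_structure:
  fixes G :: "('v, 'e) multigraph"
  assumes wf: "wf_multigraph G" and reg: "regular (2 * n) G" and fin: "finite (verts G)"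
  shows "\<exists>H :: ('v, 'e) schreier. multigraph.truncate H = G \<and> schreier_structure n H"
proof -
  obtain s t where st: "\<And>e. e \<in> edges G \<Longrightarrow> ends G e = {s e, t e}"
    and out: "\<And>v. v \<in> verts G \<Longrightarrow> card {e \<in> edges G. s e = v} = n"
    and inn: "\<And>v. v \<in> verts G \<Longrightarrow> card {e \<in> edges G. t e = v} = n"
    using eulerian_orientation[OF wf reg fin] by blast
  have stV: "s e \<in> verts G \<and> t e \<in> verts G" if "e \<in> edges G" for e
    using wf_ends_subset[OF wf that] st[OF that] by simp
  obtain g where g: "g ` edges G \<subseteq> {1..n}"
    "\<And>i. i \<in> {1..n} \<Longrightarrow> bij_betw s {e \<in> edges G. g e = i} (verts G) \<and>
      bij_betw t {e \<in> edges G. g e = i} (verts G)"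
    using regular_bipartite_factorization[OF fin fin finite_edges[OF wf reg fin] stV out inn] by blast
  have unique: "\<exists>!e. e \<in> edges G \<and> g e = i \<and> f e = v"
    if bij: "bij_betw f {e \<in> edges G. g e = i} (verts G)" and v: "v \<in> verts G" for f i v
  proof -
    have "v \<in> f ` {e \<in> edges G. g e = i}"
      using v unfolding bij_betw_imp_surj_on[OF bij] .
    then obtain e where e: "e \<in> {e \<in> edges G. g e = i}" "v = f e" by (rule imageE)
    show ?thesis
    proof (rule ex1I[of _ e])
      fix e' assume "e' \<in> edges G \<and> g e' = i \<and> f e' = v"
      then show "e' = e"
        using e by (intro inj_onD[OF bij_betw_imp_inj_on[OF bij]]) simp_all
    qed (use e in simp)
  qed
  define H where "H = multigraph.extend G (schreier.fields s t g)"
  have H: "verts H = verts G" "edges H = edges G" "ends H = ends G" "source H = s" "target H = t"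
    "gen H = g"
    by (simp_all add: H_def multigraph.defs schreier.defs)
  have "multigraph.truncate H = G"
    by (simp add: H_def multigraph.defs schreier.defs)
  moreover have "schreier_structure n H"
    unfolding schreier_structure_def H using st g(1) g(2) by (auto intro!: unique)
  ultimately show ?thesis by blast
qed

section \<open>Isomorphisms and neighborhoods\<close>

text \<open>The vertex and edge bijections are kept explicit, because isomorphisms of decorated graphs are
those for which the same pair of bijections also respects the decoration.\<close>

definition graph_iso ::
  "('v \<Rightarrow> 'w) \<Rightarrow> ('e \<Rightarrow> 'f) \<Rightarrow> ('v, 'e, 'z) multigraph_scheme \<Rightarrow> ('w, 'f, 'y) multigraph_scheme \<Rightarrow> bool"
  where
  "graph_iso \<phi> \<psi> G H \<longleftrightarrow> bij_betw \<phi> (verts G) (verts H) \<and> bij_betw \<psi> (edges G) (edges H) \<and>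
     (\<forall>e\<in>edges G. ends H (\<psi> e) = \<phi> ` ends G e)"

definition ball_verts :: "('v, 'e, 'z) multigraph_scheme \<Rightarrow> 'v \<Rightarrow> nat \<Rightarrow> 'v set" where
  "ball_verts G x r = {y \<in> verts G. \<exists>k\<le>r. (x, y) \<in> adj G ^^ k}"

definition locally_finite :: "('v, 'e, 'z) multigraph_scheme \<Rightarrow> bool" where
  "locally_finite G \<longleftrightarrow> (\<forall>v\<in>verts G. finite {e \<in> edges G. v \<in> ends G e})"

lemma nbhd_eq_induced: "nbhd G x r = induced G (ball_verts G x r)"
  by (simp add: nbhd_def ball_verts_def)

lemma induced_simps [simp]:
  "verts (induced G W) = W" "edges (induced G W) = {e \<in> edges G. ends G e \<subseteq> W}"
  "ends (induced G W) = ends G"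
  by (simp_all add: induced_def)

lemma induced_induced: "W' \<subseteq> W \<Longrightarrow> induced (induced G W) W' = induced G W'"
  by (auto simp: induced_def intro!: arg_cong2[where f = "\<lambda>a b. G\<lparr>verts := a, edges := b\<rparr>"])

lemma wf_induced: "wf_multigraph G \<Longrightarrow> wf_multigraph (induced G W)"
  by (fastforce simp: wf_multigraph_def)

lemma adj_verts: "wf_multigraph G \<Longrightarrow> (u, v) \<in> adj G \<Longrightarrow> u \<in> verts G \<and> v \<in> verts G"
  by (auto simp: adj_def dest!: wf_ends_subset)

lemma adj_relpow_verts:
  "wf_multigraph G \<Longrightarrow> (x, y) \<in> adj G ^^ k \<Longrightarrow> x \<in> verts G \<Longrightarrow> y \<in> verts G"
  by (cases k) (auto dest: adj_verts)

lemma adj_induced: "(u, v) \<in> adj (induced G W) \<longleftrightarrow> (u, v) \<in> adj G \<and> u \<in> W \<and> v \<in> W"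
  by (auto simp: adj_def)

lemma root_in_ball: "x \<in> verts G \<Longrightarrow> x \<in> ball_verts G x r"
  by (auto simp: ball_verts_def intro: exI[of _ 0])

lemma ball_verts_mono: "r \<le> s \<Longrightarrow> ball_verts G x r \<subseteq> ball_verts G x s"
  by (auto simp: ball_verts_def intro: order_trans)

lemma relpow_adj_nbhd:
  assumes "wf_multigraph G" "x \<in> verts G"
  shows "(x, y) \<in> adj G ^^ k \<Longrightarrow> k \<le> s \<Longrightarrow> (x, y) \<in> adj (nbhd G x s) ^^ k"
proof (induction k arbitrary: y)
  case (Suc k)
  then obtain z where z: "(x, z) \<in> adj G ^^ k" "(z, y) \<in> adj G" by auto
  have "\<exists>m\<le>s. (x, z) \<in> adj G ^^ m" using z(1) Suc.prems(2) by (intro exI[of _ k]) simp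
  moreover have "\<exists>m\<le>s. (x, y) \<in> adj G ^^ m"
    using Suc.prems by blast
  ultimately have "(z, y) \<in> adj (nbhd G x s)"
    using z(2) adj_verts[OF assms(1) z(2)] by (simp add: nbhd_eq_induced adj_induced ball_verts_def)
  moreover have "(x, z) \<in> adj (nbhd G x s) ^^ k" using Suc.IH[OF z(1)] Suc.prems(2) by simp
  ultimately show ?case by (rule relpow_Suc_I[rotated])
qed auto

lemma relpow_adj_induced: "(x, y) \<in> adj (induced G W) ^^ k \<Longrightarrow> (x, y) \<in> adj G ^^ k"
proof (induction k arbitrary: y)
  case (Suc k)
  from Suc.prems obtain z where "(x, z) \<in> adj (induced G W) ^^ k" "(z, y) \<in> adj (induced G W)"
    by (rule relpow_Suc_E)
  then show ?case using Suc.IH by (auto simp: adj_induced intro: relpow_Suc_I)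
qed simp

lemma nbhd_nbhd:
  assumes "wf_multigraph G" "x \<in> verts G" "r \<le> s"
  shows "nbhd (nbhd G x s) x r = nbhd G x r"
proof -
  have "ball_verts (nbhd G x s) x r = ball_verts G x r"
  proof
    show "ball_verts (nbhd G x s) x r \<subseteq> ball_verts G x r"
      by (auto simp: ball_verts_def nbhd_def dest: relpow_adj_induced)
    show "ball_verts G x r \<subseteq> ball_verts (nbhd G x s) x r"
    proof
      fix y assume y: "y \<in> ball_verts G x r"
      then obtain k where k: "k \<le> r" "(x, y) \<in> adj G ^^ k" by (auto simp: ball_verts_def)
      then have "(x, y) \<in> adj (nbhd G x s) ^^ k"
        using assms by (intro relpow_adj_nbhd) auto
      moreover have "y \<in> verts (nbhd G x s)"
        using y subsetD[OF ball_verts_mono[OF assms(3), of G x]] by (simp add: nbhd_eq_induced)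
      ultimately show "y \<in> ball_verts (nbhd G x s) x r" using k by (auto simp: ball_verts_def)
    qed
  qed
  then show ?thesis
    by (simp add: nbhd_eq_induced induced_induced ball_verts_mono[OF assms(3)])
qed

lemma finite_ball_verts:
  assumes "wf_multigraph G" "locally_finite G" "x \<in> verts G"
  shows "finite (ball_verts G x r)"
proof -
  have nbrs: "finite {w. (v, w) \<in> adj G}" if "v \<in> verts G" for v
  proof (rule finite_subset)
    show "{w. (v, w) \<in> adj G} \<subseteq> (\<Union>e\<in>{e \<in> edges G. v \<in> ends G e}. ends G e)"
      by (auto simp: adj_def)
    show "finite \<dots>"
      using assms that wf_ends_subset by (fastforce simp: locally_finite_def)
  qed
  have sphere: "finite {y. (x, y) \<in> adj G ^^ k}" for k
  proof (induction k)
    case (Suc k)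
    have "{y. (x, y) \<in> adj G ^^ Suc k} = (\<Union>z\<in>{z. (x, z) \<in> adj G ^^ k}. {w. (z, w) \<in> adj G})"
      by auto
    then show ?case
      using Suc nbrs adj_relpow_verts[OF assms(1)] assms(3) by auto
  qed simp
  have "ball_verts G x r \<subseteq> (\<Union>k\<in>{..r}. {y. (x, y) \<in> adj G ^^ k})"
    by (auto simp: ball_verts_def)
  then show ?thesis by (rule finite_subset) (auto intro: sphere)
qed

lemma finite_nbhd:
  assumes "wf_multigraph G" "locally_finite G" "x \<in> verts G"
  shows "finite (verts (nbhd G x r))" "finite (edges (nbhd G x r))"
proof -
  show fin: "finite (verts (nbhd G x r))"
    using finite_ball_verts[OF assms] by (simp add: nbhd_eq_induced)
  have "edges (nbhd G x r) \<subseteq> (\<Union>v\<in>ball_verts G x r. {e \<in> edges G. v \<in> ends G e})"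
    using wf_ends_subset[OF assms(1)] by (fastforce simp: nbhd_eq_induced)
  moreover have "finite \<dots>"
    using finite_ball_verts[OF assms] assms(2) by (auto simp: locally_finite_def ball_verts_def)
  ultimately show "finite (edges (nbhd G x r))" by (rule finite_subset)
qed

lemma graph_iso_induced:
  assumes iso: "graph_iso \<phi> \<psi> G H" and wf: "wf_multigraph G" and W: "W \<subseteq> verts G"
  shows "graph_iso \<phi> \<psi> (induced G W) (induced H (\<phi> ` W))"
proof -
  have inj: "inj_on \<phi> (verts G)" and bij: "bij_betw \<psi> (edges G) (edges H)"
    and ends: "\<And>e. e \<in> edges G \<Longrightarrow> ends H (\<psi> e) = \<phi> ` ends G e"
    using iso by (simp_all add: graph_iso_def bij_betw_def)
  have sub: "\<phi> ` ends G e \<subseteq> \<phi> ` W \<longleftrightarrow> ends G e \<subseteq> W" if "e \<in> edges G" for e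
    using inj_on_image_subset_iff[OF inj] wf_ends_subset[OF wf that] W by blast
  have "\<psi> ` {e \<in> edges G. ends G e \<subseteq> W} = {f \<in> edges H. ends H f \<subseteq> \<phi> ` W}"
  proof (intro equalityI subsetI)
    fix f assume "f \<in> \<psi> ` {e \<in> edges G. ends G e \<subseteq> W}"
    then obtain e where "e \<in> edges G" "ends G e \<subseteq> W" "f = \<psi> e" by blast
    then show "f \<in> {f \<in> edges H. ends H f \<subseteq> \<phi> ` W}"
      using bij_betwE[OF bij] by (simp add: ends sub)
  next
    fix f assume f: "f \<in> {f \<in> edges H. ends H f \<subseteq> \<phi> ` W}"
    then obtain e where e: "e \<in> edges G" "f = \<psi> e"
      using bij_betw_imp_surj_on[OF bij] by blast
    then show "f \<in> \<psi> ` {e \<in> edges G. ends G e \<subseteq> W}" using f by (simp add: ends sub)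
  qed
  moreover have "inj_on \<psi> {e \<in> edges G. ends G e \<subseteq> W}"
    using bij by (auto simp: bij_betw_def inj_on_def)
  moreover have "bij_betw \<phi> W (\<phi> ` W)"
    using inj W by (auto intro: inj_on_imp_bij_betw inj_on_subset)
  ultimately show ?thesis using ends by (auto simp: graph_iso_def bij_betw_def)
qed

lemma graph_iso_edge_cases:
  assumes "graph_iso \<phi> \<psi> G H" and "f \<in> edges H"
  obtains e where "e \<in> edges G" "f = \<psi> e" "ends H f = \<phi> ` ends G e"
proof -
  have "f \<in> \<psi> ` edges G" using assms by (simp add: graph_iso_def bij_betw_def)
  then show ?thesis using assms(1) that by (auto simp: graph_iso_def)
qed

lemma graph_iso_edge:
  "graph_iso \<phi> \<psi> G H \<Longrightarrow> e \<in> edges G \<Longrightarrow> \<psi> e \<in> edges H \<and> ends H (\<psi> e) = \<phi> ` ends G e"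
  by (auto simp: graph_iso_def bij_betw_def)

lemma graph_iso_adj_iff:
  assumes iso: "graph_iso \<phi> \<psi> G H" and wf: "wf_multigraph G" and u: "u \<in> verts G"
  shows "(\<phi> u, w) \<in> adj H \<longleftrightarrow> (\<exists>v. w = \<phi> v \<and> (u, v) \<in> adj G)"
proof
  assume "(\<phi> u, w) \<in> adj H"
  then obtain f where f: "f \<in> edges H" "ends H f = {\<phi> u, w}" by (auto simp: adj_def)
  obtain e where "e \<in> edges G" "ends H f = \<phi> ` ends G e" using graph_iso_edge_cases[OF iso f(1)] .
  then have e: "e \<in> edges G" "\<phi> ` ends G e = {\<phi> u, w}" using f(2) by simp_all
  obtain a b where ab: "a \<in> verts G" "b \<in> verts G" "ends G e = {a, b}"
    using wf e by (auto simp: wf_multigraph_def)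
  have inj: "\<phi> c = \<phi> d \<Longrightarrow> c = d" if "c \<in> verts G" "d \<in> verts G" for c d
    using iso that by (auto simp: graph_iso_def bij_betw_def inj_on_def)
  have "\<phi> a = \<phi> u \<and> \<phi> b = w \<or> \<phi> a = w \<and> \<phi> b = \<phi> u"
    using e(2) ab(3) by (auto simp: doubleton_eq_iff)
  then have "a = u \<and> \<phi> b = w \<or> \<phi> a = w \<and> b = u" using inj ab u by metis
  then show "\<exists>v. w = \<phi> v \<and> (u, v) \<in> adj G"
    using ab(3) e(1) by (auto simp: adj_def insert_commute)
next
  assume "\<exists>v. w = \<phi> v \<and> (u, v) \<in> adj G"
  then obtain v e where "w = \<phi> v" "e \<in> edges G" "ends G e = {u, v}" by (auto simp: adj_def)
  then show "(\<phi> u, w) \<in> adj H"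
    using graph_iso_edge[OF iso, of e] by (auto simp: adj_def)
qed

lemma graph_iso_relpow_iff:
  assumes "graph_iso \<phi> \<psi> G H" and "wf_multigraph G" and "x \<in> verts G"
  shows "(\<phi> x, w) \<in> adj H ^^ k \<longleftrightarrow> (\<exists>v. w = \<phi> v \<and> (x, v) \<in> adj G ^^ k)"
proof (induction k arbitrary: w)
  case (Suc k)
  have "(\<phi> x, w) \<in> adj H ^^ Suc k \<longleftrightarrow> (\<exists>z. (x, z) \<in> adj G ^^ k \<and> (\<phi> z, w) \<in> adj H)"
    by (auto simp: relcomp_unfold Suc)
  also have "\<dots> \<longleftrightarrow> (\<exists>z v. (x, z) \<in> adj G ^^ k \<and> w = \<phi> v \<and> (z, v) \<in> adj G)"
    using graph_iso_adj_iff[OF assms(1,2)] adj_relpow_verts[OF assms(2) _ assms(3)] by blast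
  also have "\<dots> \<longleftrightarrow> (\<exists>v. w = \<phi> v \<and> (x, v) \<in> adj G ^^ Suc k)"
    by (auto simp: relcomp_unfold)
  finally show ?case .
qed auto

lemma graph_iso_ball:
  assumes "graph_iso \<phi> \<psi> G H" and "wf_multigraph G" and "x \<in> verts G"
  shows "ball_verts H (\<phi> x) r = \<phi> ` ball_verts G x r"
proof -
  have "verts H = \<phi> ` verts G" using assms(1) by (auto simp: graph_iso_def bij_betw_def)
  then show ?thesis
    using adj_relpow_verts[OF assms(2) _ assms(3)]
    by (auto simp: ball_verts_def graph_iso_relpow_iff[OF assms] image_iff)
qed

lemma graph_iso_nbhd:
  assumes "graph_iso \<phi> \<psi> G H" and "wf_multigraph G" and "x \<in> verts G"
  shows "graph_iso \<phi> \<psi> (nbhd G x r) (nbhd H (\<phi> x) r)"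
  unfolding nbhd_eq_induced graph_iso_ball[OF assms]
  by (rule graph_iso_induced[OF assms(1,2)]) (auto simp: ball_verts_def)

section \<open>Weak limits of measures on spaces with a countable clopen base\<close>

text \<open>The cylinders form such a base in both spaces of rooted graphs. Borel probability measures are then determined
by their values on clopen sets. If the space is compact, limits of these values define a
measure by Caratheodory's theorem, and convergence on clopen sets is weak convergence.\<close>

locale clopen_base =
  fixes T :: "'a topology" and B :: "'a set set"
  assumes countable_base: "countable B"
    and base_clopen: "b \<in> B \<Longrightarrow> openin T b \<and> closedin T b"
    and base_refines: "openin T S \<Longrightarrow> x \<in> S \<Longrightarrow> \<exists>b\<in>B. x \<in> b \<and> b \<subseteq> S"


context clopen_base
begin

definition clopens :: "'a set set" where
  "clopens = {S. openin T S \<and> closedin T S}"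

lemma clopensI: "openin T S \<Longrightarrow> closedin T S \<Longrightarrow> S \<in> clopens"
  by (simp add: clopens_def)

lemma clopensD: "S \<in> clopens \<Longrightarrow> openin T S" "S \<in> clopens \<Longrightarrow> closedin T S"
  by (simp_all add: clopens_def)

lemma clopens_Pow: "clopens \<subseteq> Pow (topspace T)"
  using openin_subset by (auto simp: clopens_def)

lemma algebra_clopens: "algebra (topspace T) clopens"
  unfolding algebra_iff_Un using clopens_Pow by (auto simp: clopens_def)

lemma open_eq_Union_base:
  assumes "openin T S"
  shows "\<exists>F\<subseteq>B. S = \<Union>F"
proof (intro exI conjI)
  show "{b \<in> B. b \<subseteq> S} \<subseteq> B" by blast
  show "S = \<Union>{b \<in> B. b \<subseteq> S}" using base_refines[OF assms] by blast
qed

lemma space_borel: "space (borel_of_top T) = topspace T"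
  and sets_borel: "sets (borel_of_top T) = sigma_sets (topspace T) {S. openin T S}"
proof -
  have "{S. openin T S} \<subseteq> Pow (topspace T)" using openin_subset by blast
  then show "space (borel_of_top T) = topspace T"
    "sets (borel_of_top T) = sigma_sets (topspace T) {S. openin T S}"
    by (simp_all add: borel_of_top_def)
qed

lemma sets_borel_clopens: "sets (borel_of_top T) = sigma_sets (topspace T) clopens"
proof
  have "S \<in> sigma_sets (topspace T) clopens" if S: "openin T S" for S
  proof -
    obtain F where F: "F \<subseteq> B" "S = \<Union>F" using open_eq_Union_base[OF S] by blast
    have "countable F" using F(1) countable_base by (rule countable_subset)
    moreover have "F \<subseteq> sigma_sets (topspace T) clopens"
      using F(1) base_clopen by (auto simp: clopens_def)
    ultimately show ?thesis
      unfolding F(2) using sigma_algebra_sigma_sets[OF clopens_Pow]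
      by (intro sigma_algebra.countable_Union)
  qed
  then show "sets (borel_of_top T) \<subseteq> sigma_sets (topspace T) clopens"
    unfolding sets_borel by (intro sigma_sets_mono) blast
  show "sigma_sets (topspace T) clopens \<subseteq> sets (borel_of_top T)"
    unfolding sets_borel by (intro sigma_sets_mono) (auto simp: clopens_def)
qed

lemma clopens_measurable: "S \<in> clopens \<Longrightarrow> S \<in> sets (borel_of_top T)"
  by (simp add: sets_borel_clopens)

lemma continuous_imp_borel_measurable:
  assumes g: "continuous_map T euclideanreal g" and M: "sets M = sets (borel_of_top T)"
  shows "g \<in> borel_measurable M"
proof (rule borel_measurableI)
  fix U :: "real set" assume "open U"
  then have "openin T {x \<in> topspace T. g x \<in> U}"
    using g by (intro openin_continuous_map_preimage) auto
  moreover have "g -` U \<inter> space M = {x \<in> topspace T. g x \<in> U}"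
    using sets_eq_imp_space_eq[OF M] space_borel by auto
  ultimately show "g -` U \<inter> space M \<in> sets M"
    unfolding M sets_borel by auto
qed

lemma continuous_indicator:
  assumes "S \<in> clopens"
  shows "continuous_map T euclideanreal (indicator S)"
proof -
  have S: "openin T S" "openin T (topspace T - S)" "S \<subseteq> topspace T"
    using assms openin_subset by (auto simp: clopens_def closedin_def)
  have "openin T {x \<in> topspace T. indicator S x \<in> U}" for U :: "real set"
  proof -
    have "{x \<in> topspace T. indicator S x \<in> U} =
        (if 1 \<in> U then S else {}) \<union> (if 0 \<in> U then topspace T - S else {})"
      using S(3) by (auto simp: indicator_def)
    then show ?thesis using S by auto
  qed
  then show ?thesis by (auto simp: continuous_map_def)
qed

lemma prob_measure_eqI_clopens:
  assumes "prob_space M" "sets M = sets (borel_of_top T)"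
    and "prob_space N" "sets N = sets (borel_of_top T)"
    and eq: "\<And>S. S \<in> clopens \<Longrightarrow> measure M S = measure N S"
  shows "M = N"
proof -
  interpret M: prob_space M by fact
  interpret N: prob_space N by fact
  interpret algebra "topspace T" clopens by (rule algebra_clopens)
  show ?thesis
  proof (rule measure_eqI_generator_eq[where A = "\<lambda>_ :: nat. topspace T" and E = clopens])
    show "Int_stable clopens" by (rule Int_stable)
    show "emeasure M S = emeasure N S" if "S \<in> clopens" for S
      using eq[OF that] by (simp add: M.emeasure_eq_measure N.emeasure_eq_measure)
  qed (use assms clopens_Pow in \<open>auto simp: sets_borel_clopens M.emeasure_eq_measure\<close>)
qed

lemma weak_limit_unique:
  assumes M: "prob_space M" "sets M = sets (borel_of_top T)"
    and N: "prob_space N" "sets N = sets (borel_of_top T)"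
    and lim: "converges_weakly T P M" "converges_weakly T P N"
  shows "M = N"
proof (rule prob_measure_eqI_clopens[OF M N])
  fix S assume S: "S \<in> clopens"
  have "bounded (indicator S ` topspace T :: real set)"
    by (rule bounded_subset[of "{0, 1}"]) (auto simp: indicator_def)
  then have "(\<lambda>i. \<integral>x. (indicator S x :: real) \<partial>P i) \<longlonglongrightarrow> (\<integral>x. (indicator S x :: real) \<partial>M)"
    "(\<lambda>i. \<integral>x. (indicator S x :: real) \<partial>P i) \<longlonglongrightarrow> (\<integral>x. (indicator S x :: real) \<partial>N)"
    using lim continuous_indicator[OF S] unfolding converges_weakly_def by blast+
  then have "(\<integral>x. (indicator S x :: real) \<partial>M) = (\<integral>x. (indicator S x :: real) \<partial>N)" by (rule LIMSEQ_unique)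
  moreover have "S \<subseteq> topspace T" using S clopens_Pow by blast
  ultimately show "measure M S = measure N S"
    using sets_eq_imp_space_eq[OF M(2)] sets_eq_imp_space_eq[OF N(2)] space_borel
    by (simp add: Int_absorb2)
qed

text \<open>By compactness every clopen set is a finite union of basic sets.\<close>

lemma countable_clopens:
  assumes "compact_space T"
  shows "countable clopens"
proof -
  have "clopens \<subseteq> Union ` {F. finite F \<and> F \<subseteq> B}"
  proof
    fix S assume S: "S \<in> clopens"
    obtain F where F: "F \<subseteq> B" "S = \<Union>F" using open_eq_Union_base[OF clopensD(1)[OF S]] by blast
    have "compactin T S" using closedin_compact_space[OF assms clopensD(2)[OF S]] .
    moreover have "\<And>U. U \<in> F \<Longrightarrow> openin T U" using F(1) base_clopen by blast
    ultimately obtain F' where "finite F'" "F' \<subseteq> F" "S \<subseteq> \<Union>F'"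
      using F(2) unfolding compactin_def by (metis order_refl)
    moreover from this F(2) have "S = \<Union>F'" by blast
    ultimately show "S \<in> Union ` {F. finite F \<and> F \<subseteq> B}" using F(1) by blast
  qed
  moreover have "countable {F. finite F \<and> F \<subseteq> B}"
    using countable_base by (rule countable_Collect_finite_subset)
  ultimately show ?thesis by (meson countable_image countable_subset)
qed

text \<open>The diagonal argument, in the form of sequential compactness of the cube of all functions from \<open>\<nat>\<close> to
\<open>[0, 1]\<close>.\<close>

lemma convergent_subsequence_on_clopens:
  fixes P :: "nat \<Rightarrow> 'a measure"
  assumes comp: "compact_space T" and P: "\<And>i. prob_space (P i)"
  obtains s where "strict_mono s"
    and "\<And>S. S \<in> clopens \<Longrightarrow> convergent (\<lambda>i. measure (P (s i)) S)"
proof -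
  define K :: "(nat \<Rightarrow> real) set" where "K = (\<Pi>\<^sub>E k\<in>UNIV. {0..1})"
  have "compactin (product_topology (\<lambda>_. euclideanreal) (UNIV :: nat set)) K"
    unfolding K_def compactin_PiE by simp
  then have "compact K" by (simp add: euclidean_product_topology)
  then have "seq_compact K" by (simp add: compact_eq_seq_compact_metric)
  define m where "m i k = measure (P i) (from_nat_into clopens k)" for i k
  have "m i \<in> K" for i
    using prob_space.prob_le_1[OF P] by (auto simp: K_def m_def PiE_iff)
  then obtain l s where s: "strict_mono s" and l: "(m \<circ> s) \<longlonglongrightarrow> l"
    using \<open>seq_compact K\<close> unfolding seq_compact_def by metis
  have "convergent (\<lambda>i. measure (P (s i)) S)" if S: "S \<in> clopens" for S
  proof -
    obtain k where k: "from_nat_into clopens k = S"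
      using from_nat_into_surj[OF countable_clopens[OF comp] S] by blast
    have "(\<lambda>i. (m \<circ> s) i k) \<longlonglongrightarrow> l k"
      using continuous_on_tendsto_compose[OF continuous_on_product_coordinates l, of k] by simp
    then show ?thesis by (auto simp: m_def k convergent_def)
  qed
  then show thesis using that s by blast
qed

text \<open>The pointwise limit on clopen sets is additive, and by compactness it is continuous at the empty set:
a decreasing sequence of clopen sets with empty intersection is eventually empty.\<close>

lemma limit_measure_exists:
  fixes P :: "nat \<Rightarrow> 'a measure"
  assumes comp: "compact_space T"
    and P: "\<And>i. prob_space (P i)" "\<And>i. sets (P i) = sets (borel_of_top T)"
    and conv: "\<And>S. S \<in> clopens \<Longrightarrow> convergent (\<lambda>i. measure (P i) S)"
  obtains N where "prob_space N" "sets N = sets (borel_of_top T)"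
    and "\<And>S. S \<in> clopens \<Longrightarrow> (\<lambda>i. measure (P i) S) \<longlonglongrightarrow> measure N S"
proof -
  interpret algebra "topspace T" clopens by (rule algebra_clopens)
  define f where "f S = lim (\<lambda>i. measure (P i) S)" for S
  have f: "(\<lambda>i. measure (P i) S) \<longlonglongrightarrow> f S" if "S \<in> clopens" for S
    using conv[OF that] by (simp add: f_def convergent_LIMSEQ_iff)
  have clopen_sets: "S \<in> sets (P i)" if "S \<in> clopens" for S i
    using clopens_measurable[OF that] P(2) by simp
  have f0: "f S \<ge> 0" if "S \<in> clopens" for S
    using f[OF that] by (rule LIMSEQ_le_const) auto
  have f_empty: "f {} = 0" using f[OF empty_sets] by (simp add: LIMSEQ_const_iff)
  have fadd: "f (S \<union> S') = f S + f S'" if S: "S \<in> clopens" "S' \<in> clopens" "S \<inter> S' = {}" for S S'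
  proof (rule LIMSEQ_unique[OF f])
    have "measure (P i) (S \<union> S') = measure (P i) S + measure (P i) S'" for i
    proof -
      interpret prob_space "P i" by (rule P(1))
      show ?thesis using S clopen_sets by (intro finite_measure_Union) auto
    qed
    then show "(\<lambda>i. measure (P i) (S \<union> S')) \<longlonglongrightarrow> f S + f S'"
      using tendsto_add[OF f f] S by simp
  qed (use S in auto)
  have "\<exists>\<mu>. (\<forall>S\<in>clopens. \<mu> S = ennreal (f S)) \<and>
      measure_space (topspace T) (sigma_sets (topspace T) clopens) \<mu>"
  proof (rule caratheodory_empty_continuous)
    show "positive clopens (\<lambda>S. ennreal (f S))" by (simp add: positive_def f_empty)
    show "additive clopens (\<lambda>S. ennreal (f S))"
      unfolding additive_def using fadd f0 by simp
    show "ennreal (f S) \<noteq> \<infinity>" for S by simp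
    fix A :: "nat \<Rightarrow> 'a set"
    assume A: "range A \<subseteq> clopens" "decseq A" "(\<Inter>i. A i) = {}"
    have "\<exists>k. A k = {}"
    proof (rule ccontr)
      assume "\<not> ?thesis"
      then have "(\<Inter>i. A i) \<noteq> {}"
        using A by (intro compact_space_imp_nest[OF comp]) (auto simp: clopens_def)
      then show False using A(3) by simp
    qed
    then obtain k where "A k = {}" ..
    then have "A i = {}" if "i \<ge> k" for i using A(2) that by (fastforce simp: decseq_def)
    then have "\<forall>\<^sub>F i in sequentially. ennreal (f (A i)) = 0"
      by (intro eventually_sequentiallyI[of k]) (simp add: f_empty)
    then show "(\<lambda>i. ennreal (f (A i))) \<longlonglongrightarrow> 0" by (rule tendsto_eventually)
  qed
  then obtain \<mu> where \<mu>: "\<forall>S\<in>clopens. \<mu> S = ennreal (f S)"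
    "measure_space (topspace T) (sigma_sets (topspace T) clopens) \<mu>" by (elim exE conjE)
  define N where "N = measure_of (topspace T) clopens \<mu>"
  have sets: "sets N = sets (borel_of_top T)"
    using clopens_Pow by (simp add: N_def sets_borel_clopens)
  have space: "space N = topspace T" using clopens_Pow by (simp add: N_def)
  have emeasure_N: "emeasure N S = ennreal (f S)" if "S \<in> clopens" for S
  proof -
    have "positive (sets N) \<mu>" "countably_additive (sets N) \<mu>"
      using \<mu>(2) unfolding sets sets_borel_clopens measure_space_def by blast+
    then have "emeasure N S = \<mu> S"
      using clopens_measurable[OF that] by (intro emeasure_measure_of[OF N_def clopens_Pow]) (simp_all add: sets)
    then show ?thesis using \<mu>(1) that by simp
  qed
  have "f (topspace T) = 1"
  proof (rule LIMSEQ_unique[OF f])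
    have "measure (P i) (topspace T) = 1" for i
      using prob_space.prob_space[OF P(1)[of i]] sets_eq_imp_space_eq[OF P(2)[of i]] space_borel by simp
    then show "(\<lambda>i. measure (P i) (topspace T)) \<longlonglongrightarrow> 1" by simp
  qed simp
  then have "prob_space N" by (intro prob_spaceI) (simp add: space emeasure_N)
  moreover have "measure N S = f S" if "S \<in> clopens" for S
    using emeasure_N[OF that] f0[OF that] by (simp add: measure_def)
  ultimately show thesis using that sets f by simp
qed

text \<open>On a compact space a continuous function is a uniform limit of finite combinations of
indicators of clopen sets.\<close>

lemma converges_weakly_of_clopens:
  fixes P :: "nat \<Rightarrow> 'a measure"
  assumes comp: "compact_space T"
    and P: "\<And>i. prob_space (P i)" "\<And>i. sets (P i) = sets (borel_of_top T)"
    and N: "prob_space N" "sets N = sets (borel_of_top T)"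
    and lim: "\<And>S. S \<in> clopens \<Longrightarrow> (\<lambda>i. measure (P i) S) \<longlonglongrightarrow> measure N S"
  shows "converges_weakly T P N"
  unfolding converges_weakly_def
proof (intro allI impI)
  fix g :: "'a \<Rightarrow> real" assume "continuous_map T euclideanreal g \<and> bounded (g ` topspace T)"
  then have g: "continuous_map T euclideanreal g" and "bounded (g ` topspace T)" by auto
  then obtain C where C: "\<And>x. x \<in> topspace T \<Longrightarrow> \<bar>g x\<bar> \<le> C"
    by (auto simp: bounded_iff)
  interpret algebra "topspace T" clopens by (rule algebra_clopens)
  have space: "space M = topspace T" if "sets M = sets (borel_of_top T)" for M
    using sets_eq_imp_space_eq[OF that] space_borel by simp
  have gint: "integrable M g" if "prob_space M" "sets M = sets (borel_of_top T)" for M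
  proof -
    interpret prob_space M by fact
    show ?thesis
      using continuous_imp_borel_measurable[OF g that(2)] C
      by (intro integrable_const_bound[of _ C]) (auto simp: space[OF that(2)])
  qed
  \<comment> \<open>On a finite union of clopen sets on which \<open>g\<close> varies little, a combination \<open>h\<close> of indicators of
    clopen sets is uniformly close to \<open>g\<close>, and the integrals of \<open>h\<close> converge by assumption. In the
    induction step only the part \<open>D\<close> of the new set outside the old ones is added.\<close>
  have step: "\<exists>h. (\<forall>M. prob_space M \<and> sets M = sets (borel_of_top T) \<longrightarrow> integrable M h) \<and>
      (\<lambda>i. \<integral>x. h x \<partial>P i) \<longlonglongrightarrow> (\<integral>x. h x \<partial>N) \<and>
      (\<forall>x\<in>\<Union>F. \<bar>g x - h x\<bar> \<le> e) \<and> (\<forall>x. x \<notin> \<Union>F \<longrightarrow> h x = 0)"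
    if "finite F" "F \<subseteq> clopens" "\<forall>b\<in>F. \<exists>c. \<forall>x\<in>b. \<bar>g x - c\<bar> \<le> e" for F e
    using that
  proof (induction F)
    case empty
    show ?case by (intro exI[of _ "\<lambda>_. 0"]) auto
  next
    case (insert b F)
    have F: "F \<subseteq> clopens" "\<forall>b\<in>F. \<exists>c. \<forall>x\<in>b. \<bar>g x - c\<bar> \<le> e"
      using insert.prems by simp_all
    from insert.IH[OF F] obtain h where
      h0: "\<forall>M. prob_space M \<and> sets M = sets (borel_of_top T) \<longrightarrow> integrable M h"
      and h2: "(\<lambda>i. \<integral>x. h x \<partial>P i) \<longlonglongrightarrow> (\<integral>x. h x \<partial>N)"
      and h3: "\<forall>x\<in>\<Union>F. \<bar>g x - h x\<bar> \<le> e" and h4: "\<forall>x. x \<notin> \<Union>F \<longrightarrow> h x = 0"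
      by (elim exE conjE)
    have h1: "integrable M h" if "prob_space M" "sets M = sets (borel_of_top T)" for M
      using h0 that by blast
    obtain c where c: "\<forall>x\<in>b. \<bar>g x - c\<bar> \<le> e" using insert.prems(2) by blast
    define D where "D = b - \<Union>F"
    have D: "D \<in> clopens"
      using insert.prems insert.hyps unfolding D_def by (intro Diff finite_Union) auto
    have D_measurable: "D \<in> sets M" if "sets M = sets (borel_of_top T)" for M
      using clopens_measurable[OF D] that by simp
    define h' where "h' x = h x + c * indicator D x" for x
    have ind: "integrable M (\<lambda>x. c * indicator D x)" and
      int: "(\<integral>x. h' x \<partial>M) = (\<integral>x. h x \<partial>M) + c * measure M D"
      if M: "prob_space M" "sets M = sets (borel_of_top T)" for M
    proof -
      interpret prob_space M by fact
      show *: "integrable M (\<lambda>x. c * indicator D x)"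
        using D_measurable[OF M(2)] by (intro integrable_mult_right integrable_real_indicator) (simp_all add: less_top[symmetric])
      have "D \<inter> space M = D" using D clopens_Pow space[OF M(2)] by blast
      then have "(\<integral>x. c * indicator D x \<partial>M) = c * measure M D" by simp
      then show "(\<integral>x. h' x \<partial>M) = (\<integral>x. h x \<partial>M) + c * measure M D"
        unfolding h'_def using Bochner_Integration.integral_add[OF h1[OF M] *] by simp
    qed
    have "(\<lambda>i. \<integral>x. h' x \<partial>P i) \<longlonglongrightarrow> (\<integral>x. h' x \<partial>N)"
      unfolding int[OF P] int[OF N] by (intro tendsto_intros h2 lim D)
    moreover have "integrable M h'" if "prob_space M" "sets M = sets (borel_of_top T)" for M
      unfolding h'_def using h1[OF that] ind[OF that] by (rule Bochner_Integration.integrable_add)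
    moreover have "\<bar>g x - h' x\<bar> \<le> e" if "x \<in> \<Union>(insert b F)" for x
    proof (cases "x \<in> \<Union>F")
      case True
      then have "x \<notin> D" by (simp add: D_def)
      then have "h' x = h x" by (simp add: h'_def)
      then show ?thesis using bspec[OF h3 True] by simp
    next
      case False
      then have "x \<in> b" "h x = 0" using that h4 by auto
      then show ?thesis using c False by (simp add: h'_def D_def)
    qed
    moreover have "h' x = 0" if "x \<notin> \<Union>(insert b F)" for x
      using that h4 by (simp add: h'_def D_def)
    ultimately show ?case by blast
  qed
  show "(\<lambda>i. \<integral>x. g x \<partial>P i) \<longlonglongrightarrow> (\<integral>x. g x \<partial>N)"
  proof (rule LIMSEQ_I)
    fix r :: real assume r: "r > 0"
    define e where "e = r / 4"
    have e: "e > 0" using r by (simp add: e_def)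
    define F where "F = {b \<in> B. \<exists>c. \<forall>x\<in>b. \<bar>g x - c\<bar> \<le> e}"
    have "topspace T \<subseteq> \<Union>F"
    proof
      fix x assume x: "x \<in> topspace T"
      have "openin T {y \<in> topspace T. g y \<in> ball (g x) e}"
        using g by (intro openin_continuous_map_preimage) auto
      from base_refines[OF this, of x] x e obtain b where
        b: "b \<in> B" "x \<in> b" "b \<subseteq> {y \<in> topspace T. g y \<in> ball (g x) e}" by auto
      have "\<bar>g y - g x\<bar> \<le> e" if "y \<in> b" for y
        using subsetD[OF b(3) that] by (simp add: dist_real_def abs_minus_commute)
      then have "b \<in> F" unfolding F_def using b(1) by blast
      then show "x \<in> \<Union>F" using b(2) by blast
    qed
    moreover have "openin T b" if "b \<in> F" for b using that base_clopen by (auto simp: F_def)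
    ultimately have "\<exists>F'. finite F' \<and> F' \<subseteq> F \<and> topspace T \<subseteq> \<Union>F'"
      using comp by (intro compactinD) (simp_all add: compact_space_def)
    then obtain F' where F': "finite F'" "F' \<subseteq> F" "topspace T \<subseteq> \<Union>F'" by (elim exE conjE)
    have "F' \<subseteq> clopens" "\<forall>b\<in>F'. \<exists>c. \<forall>x\<in>b. \<bar>g x - c\<bar> \<le> e"
      using F'(2) base_clopen clopensI unfolding F_def by blast+
    from step[OF F'(1) this] obtain h where
      h0: "\<forall>M. prob_space M \<and> sets M = sets (borel_of_top T) \<longrightarrow> integrable M h"
      and h2: "(\<lambda>i. \<integral>x. h x \<partial>P i) \<longlonglongrightarrow> (\<integral>x. h x \<partial>N)"
      and h3: "\<forall>x\<in>\<Union>F'. \<bar>g x - h x\<bar> \<le> e"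
      by (elim exE conjE)
    have h1: "integrable M h" if "prob_space M" "sets M = sets (borel_of_top T)" for M
      using h0 that by blast
    have h3: "\<bar>g x - h x\<bar> \<le> e" if "x \<in> topspace T" for x
      using bspec[OF h3] F'(3) that by blast
    have close: "\<bar>(\<integral>x. g x \<partial>M) - (\<integral>x. h x \<partial>M)\<bar> \<le> e"
      if M: "prob_space M" "sets M = sets (borel_of_top T)" for M
    proof -
      interpret prob_space M by fact
      have "\<bar>(\<integral>x. g x \<partial>M) - (\<integral>x. h x \<partial>M)\<bar> = \<bar>\<integral>x. g x - h x \<partial>M\<bar>"
        using gint[OF M] h1[OF M] by simp
      also have "\<dots> \<le> (\<integral>x. \<bar>g x - h x\<bar> \<partial>M)" by (rule integral_abs_bound)
      also have "\<dots> \<le> (\<integral>x. e \<partial>M)"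
        using gint[OF M] h1[OF M] h3 space[OF M(2)]
        by (intro integral_mono) auto
      finally show ?thesis by (simp add: prob_space)
    qed
    obtain n0 where n0: "\<And>i. i \<ge> n0 \<Longrightarrow> \<bar>(\<integral>x. h x \<partial>P i) - (\<integral>x. h x \<partial>N)\<bar> < e"
      using LIMSEQ_D[OF h2 e] by auto
    have "\<bar>(\<integral>x. g x \<partial>P i) - (\<integral>x. g x \<partial>N)\<bar> < r" if "i \<ge> n0" for i
      using n0[OF that] close[OF P[of i]] close[OF N] e unfolding e_def by linarith
    then show "\<exists>n0. \<forall>i\<ge>n0. norm ((\<integral>x. g x \<partial>P i) - (\<integral>x. g x \<partial>N)) < r"
      by auto
  qed
qed

theorem weakly_convergent_subsequence:
  fixes P :: "nat \<Rightarrow> 'a measure"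
  assumes comp: "compact_space T"
    and P: "\<And>i. prob_space (P i)" "\<And>i. sets (P i) = sets (borel_of_top T)"
  obtains s N where "strict_mono s" "prob_space N" "sets N = sets (borel_of_top T)"
    "converges_weakly T (P \<circ> s) N"
proof -
  obtain s where s: "strict_mono s" "\<And>S. S \<in> clopens \<Longrightarrow> convergent (\<lambda>i. measure (P (s i)) S)"
    using convergent_subsequence_on_clopens[of P] comp P(1) by blast
  obtain N where N: "prob_space N" "sets N = sets (borel_of_top T)"
    "\<And>S. S \<in> clopens \<Longrightarrow> (\<lambda>i. measure (P (s i)) S) \<longlonglongrightarrow> measure N S"
    using limit_measure_exists[OF comp P(1) P(2) s(2)] by blast
  have "converges_weakly T (\<lambda>i. P (s i)) N"
    using converges_weakly_of_clopens[OF comp P(1) P(2) N] .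
  then show thesis using that s(1) N(1,2) by (simp add: comp_def)
qed

end

section \<open>The cylinder topology on isomorphism classes of rooted graphs\<close>

text \<open>A decoration attaches to every edge a list of vertices among its endpoints and a number. Unlabeled graphs carry the trivial
decoration, Schreier graphs carry source, target and label, so that both spaces are
instances of one construction. An isomorphism transports the listed vertices and
preserves the number.\<close>

locale decorated_graphs =
  fixes X :: "((nat, nat, 'z) multigraph_scheme \<times> nat) set"
    and dec :: "(nat, nat, 'z) multigraph_scheme \<Rightarrow> nat \<Rightarrow> nat list \<times> nat"
  assumes dec_induced: "dec (induced G W) = dec G"
    and X_root: "(G, x) \<in> X \<Longrightarrow> x \<in> verts G"
    and X_wf: "(G, x) \<in> X \<Longrightarrow> wf_multigraph G"
    and X_locally_finite: "(G, x) \<in> X \<Longrightarrow> locally_finite G"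
    and X_dec: "(G, x) \<in> X \<Longrightarrow> e \<in> edges G \<Longrightarrow> set (fst (dec G e)) \<subseteq> ends G e"
begin

definition dec_preserving where
  "dec_preserving \<phi> \<psi> G H \<longleftrightarrow> (\<forall>e\<in>edges G. dec H (\<psi> e) = map_prod (map \<phi>) id (dec G e))"

definition iso where
  "iso p q \<longleftrightarrow> (\<exists>\<phi> \<psi>. graph_iso \<phi> \<psi> (fst p) (fst q) \<and> dec_preserving \<phi> \<psi> (fst p) (fst q) \<and>
     \<phi> (snd p) = snd q)"

definition good where
  "good p \<longleftrightarrow> wf_multigraph (fst p) \<and> snd p \<in> verts (fst p) \<and>
     (\<forall>e\<in>edges (fst p). set (fst (dec (fst p) e)) \<subseteq> ends (fst p) e)"

definition nb where
  "nb r p = (nbhd (fst p) (snd p) r, snd p)"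

lemma X_imp_good: "p \<in> X \<Longrightarrow> good p"
  using X_wf X_root X_dec by (cases p) (auto simp: good_def)

lemma good_nb: "good p \<Longrightarrow> good (nb r p)"
  by (auto simp: good_def nb_def nbhd_eq_induced dec_induced intro: wf_induced root_in_ball)

lemma nb_nb: "good p \<Longrightarrow> r \<le> s \<Longrightarrow> nb r (nb s p) = nb r p"
  by (auto simp: good_def nb_def nbhd_nbhd)

lemma iso_refl: "iso p p"
  unfolding iso_def
  by (intro exI[of _ id]) (auto simp: graph_iso_def dec_preserving_def map_prod_def)

lemma iso_trans: "iso p q \<Longrightarrow> iso q u \<Longrightarrow> iso p u"
proof -
  assume "iso p q" "iso q u"
  then obtain \<phi> \<psi> \<phi>' \<psi>' where
    *: "graph_iso \<phi> \<psi> (fst p) (fst q)" "dec_preserving \<phi> \<psi> (fst p) (fst q)" "\<phi> (snd p) = snd q"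
      "graph_iso \<phi>' \<psi>' (fst q) (fst u)" "dec_preserving \<phi>' \<psi>' (fst q) (fst u)" "\<phi>' (snd q) = snd u"
    by (auto simp: iso_def)
  have mem: "\<psi> e \<in> edges (fst q)" if "e \<in> edges (fst p)" for e
    using * that by (auto simp: graph_iso_def bij_betw_def)
  have "graph_iso (\<phi>' \<circ> \<phi>) (\<psi>' \<circ> \<psi>) (fst p) (fst u)"
    using * mem by (auto simp: graph_iso_def image_image intro: bij_betw_trans)
  moreover have "dec_preserving (\<phi>' \<circ> \<phi>) (\<psi>' \<circ> \<psi>) (fst p) (fst u)"
    using * mem by (auto simp: dec_preserving_def map_prod_def split: prod.splits)
  ultimately show ?thesis using * unfolding iso_def by (metis comp_apply)
qed

text \<open>A cylinder may be given by an arbitrary rooted graph \<open>U\<close>, and two neighborhoods isomorphic to \<open>U\<close> must be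
isomorphic to each other; so \<open>q\<close> is arbitrary here. The inverse bijections form an isomorphism because
\<open>\<phi>\<close> is injective on the vertices of \<open>p\<close>, which contain all endpoints of its edges.\<close>

lemma iso_sym:
  assumes "good p" "iso p q"
  shows "iso q p"
proof -
  obtain \<phi> \<psi> where iso: "graph_iso \<phi> \<psi> (fst p) (fst q)"
    and dec: "dec_preserving \<phi> \<psi> (fst p) (fst q)" and root: "\<phi> (snd p) = snd q"
    using assms by (auto simp: iso_def)
  define \<phi>' where "\<phi>' = inv_into (verts (fst p)) \<phi>"
  define \<psi>' where "\<psi>' = inv_into (edges (fst p)) \<psi>"
  have bij: "bij_betw \<phi> (verts (fst p)) (verts (fst q))" "bij_betw \<psi> (edges (fst p)) (edges (fst q))"
    using iso by (auto simp: graph_iso_def)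
  have inv: "\<phi>' (\<phi> v) = v" if "v \<in> verts (fst p)" for v
    using bij that by (simp add: \<phi>'_def bij_betw_def)
  have inv': "\<psi>' (\<psi> e) = e" if "e \<in> edges (fst p)" for e
    using bij that by (simp add: \<psi>'_def bij_betw_def)
  have surj: "\<exists>e\<in>edges (fst p). f = \<psi> e" if "f \<in> edges (fst q)" for f
    using bij_betw_imp_surj_on[OF bij(2)] that by blast
  have sub: "ends (fst p) e \<subseteq> verts (fst p)" "set (fst (dec (fst p) e)) \<subseteq> verts (fst p)"
    if "e \<in> edges (fst p)" for e
  proof -
    show "ends (fst p) e \<subseteq> verts (fst p)"
      using wf_ends_subset[OF _ that] assms(1) by (simp add: good_def)
    then show "set (fst (dec (fst p) e)) \<subseteq> verts (fst p)"
      using assms(1) that unfolding good_def by (meson order_trans)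
  qed
  have "graph_iso \<phi>' \<psi>' (fst q) (fst p)"
    unfolding graph_iso_def
  proof (intro conjI ballI)
    fix f assume "f \<in> edges (fst q)"
    then obtain e where e: "e \<in> edges (fst p)" "f = \<psi> e" using surj by blast
    have "\<phi>' ` \<phi> ` ends (fst p) e = (\<lambda>v. v) ` ends (fst p) e"
      unfolding image_image using inv sub(1)[OF e(1)] by (intro image_cong) auto
    then show "ends (fst p) (\<psi>' f) = \<phi>' ` ends (fst q) f"
      using graph_iso_edge[OF iso e(1)] e inv' by simp
  qed (use bij in \<open>simp_all add: \<phi>'_def \<psi>'_def bij_betw_inv_into\<close>)
  moreover have "dec_preserving \<phi>' \<psi>' (fst q) (fst p)"
    unfolding dec_preserving_def
  proof
    fix f assume "f \<in> edges (fst q)"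
    then obtain e where e: "e \<in> edges (fst p)" "f = \<psi> e" using surj by blast
    have "map \<phi>' (map \<phi> (fst (dec (fst p) e))) = fst (dec (fst p) e)"
      using inv sub(2)[OF e(1)] by (auto simp: map_idI subset_iff)
    then show "dec (fst p) (\<psi>' f) = map_prod (map \<phi>') id (dec (fst q) f)"
      using dec e inv' by (simp add: dec_preserving_def prod_eq_iff)
  qed
  moreover have "\<phi>' (snd q) = snd p"
    using inv[of "snd p"] assms(1) root by (simp add: good_def)
  ultimately show ?thesis unfolding iso_def by blast
qed

lemma iso_nb:
  assumes "good p" "iso p q"
  shows "iso (nb r p) (nb r q)"
proof -
  obtain \<phi> \<psi> where iso: "graph_iso \<phi> \<psi> (fst p) (fst q)"
    and dec: "dec_preserving \<phi> \<psi> (fst p) (fst q)" and root: "\<phi> (snd p) = snd q"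
    using assms by (auto simp: iso_def)
  have "graph_iso \<phi> \<psi> (fst (nb r p)) (fst (nb r q))"
    using graph_iso_nbhd[OF iso, of "snd p" r] assms(1) root by (simp add: nb_def good_def)
  moreover have "dec_preserving \<phi> \<psi> (fst (nb r p)) (fst (nb r q))"
    using dec by (simp add: dec_preserving_def nb_def nbhd_eq_induced dec_induced)
  ultimately show ?thesis using root unfolding iso_def by (auto simp: nb_def)
qed

lemma iso_nb_antimono:
  assumes "good p" "good q" "r \<le> s" "iso (nb s p) (nb s q)"
  shows "iso (nb r p) (nb r q)"
  using iso_nb[OF good_nb[OF assms(1)] assms(4)] nb_nb assms by metis

definition rel where "rel = {(p, q). p \<in> X \<and> q \<in> X \<and> iso p q}"

definition cls where "cls p = rel `` {p}"

definition cyl where "cyl r U = {A \<in> X // rel. \<exists>p\<in>A. iso (nb r p) U}"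

definition cyl_top where "cyl_top = topology_generated_by {cyl r U | r U. True}"

lemma equiv_rel: "equiv X rel"
proof (rule equivI)
  show "rel \<subseteq> X \<times> X" by (auto simp: rel_def)
  show "refl_on X rel" by (auto simp: rel_def refl_on_def iso_refl)
  show "sym rel" by (auto simp: rel_def sym_def intro: iso_sym X_imp_good)
  show "trans rel" by (auto simp: rel_def trans_def intro: iso_trans)
qed

lemma cls_in: "p \<in> X \<Longrightarrow> cls p \<in> X // rel"
  unfolding cls_def by (rule quotientI)

lemma mem_cls: "q \<in> cls p \<longleftrightarrow> p \<in> X \<and> q \<in> X \<and> iso p q"
  by (auto simp: cls_def rel_def)

lemma classes_cases:
  assumes "A \<in> X // rel" obtains p where "p \<in> X" "A = cls p"
  using assms unfolding cls_def by (rule quotientE)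

lemma cls_eq_iff: "p \<in> X \<Longrightarrow> q \<in> X \<Longrightarrow> cls p = cls q \<longleftrightarrow> iso p q"
  unfolding cls_def using eq_equiv_class_iff[OF equiv_rel] by (simp add: rel_def)

lemma cls_in_cyl: "p \<in> X \<Longrightarrow> cls p \<in> cyl r U \<longleftrightarrow> iso (nb r p) U"
proof -
  assume p: "p \<in> X"
  have "iso (nb r p) U" if "q \<in> cls p" "iso (nb r q) U" for q
    using that iso_nb[OF X_imp_good[OF p], of q r] iso_trans unfolding mem_cls by blast
  moreover have "p \<in> cls p" using p by (simp add: mem_cls iso_refl)
  ultimately show ?thesis using cls_in[OF p] by (auto simp: cyl_def)
qed

lemma cyl_subset: "cyl r U \<subseteq> X // rel"
  by (auto simp: cyl_def)

lemma cls_in_own_cyl: "p \<in> X \<Longrightarrow> cls p \<in> cyl r (nb r p)"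
  by (simp add: cls_in_cyl iso_refl)

lemma own_cyl_subset: "p \<in> X \<Longrightarrow> cls p \<in> cyl r U \<Longrightarrow> cyl r (nb r p) \<subseteq> cyl r U"
proof
  fix A assume p: "p \<in> X" "cls p \<in> cyl r U" and A: "A \<in> cyl r (nb r p)"
  obtain q where q: "q \<in> X" "A = cls q" using A cyl_subset by (blast elim: classes_cases)
  then show "A \<in> cyl r U" using A p iso_trans by (auto simp: cls_in_cyl)
qed

lemma own_cyl_antimono:
  assumes "p \<in> X" "r \<le> s"
  shows "cyl s (nb s p) \<subseteq> cyl r (nb r p)"
proof
  fix A assume A: "A \<in> cyl s (nb s p)"
  then obtain q where q: "q \<in> X" "A = cls q" using cyl_subset by (blast elim: classes_cases)
  then show "A \<in> cyl r (nb r p)"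
    using A assms iso_nb_antimono X_imp_good by (simp add: cls_in_cyl)
qed

lemma openin_cyl: "openin cyl_top (cyl r U)"
  unfolding cyl_top_def by (rule topology_generated_by_Basis) blast

lemma topspace_cyl_top: "topspace cyl_top = X // rel"
proof
  show "topspace cyl_top \<subseteq> X // rel"
    unfolding cyl_top_def topology_generated_by_topspace using cyl_subset by blast
  show "X // rel \<subseteq> topspace cyl_top"
  proof
    fix A assume "A \<in> X // rel"
    then obtain p where p: "p \<in> X" "A = cls p" by (rule classes_cases)
    show "A \<in> topspace cyl_top"
      unfolding p(2) using openin_subset[OF openin_cyl] cls_in_own_cyl[OF p(1), of 0] by (rule subsetD)
  qed
qed

text \<open>Cylinders of the same radius are equal or disjoint, and cylinders of larger radius around the same class
are smaller; hence the cylinders around a point form a neighborhood base, and the given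
subbase is a base.\<close>

lemma openin_cyl_top_iff:
  "openin cyl_top S \<longleftrightarrow> S \<subseteq> X // rel \<and> (\<forall>p\<in>X. cls p \<in> S \<longrightarrow> (\<exists>r. cyl r (nb r p) \<subseteq> S))"
proof
  assume S: "openin cyl_top S"
  have "\<exists>r. cyl r (nb r p) \<subseteq> S" if p: "p \<in> X" "cls p \<in> S" for p
  proof -
    have "generate_topology_on {cyl r U | r U. True} S"
      using S by (simp add: cyl_top_def openin_topology_generated_by_iff)
    then show ?thesis using p(2)
    proof induction
      case Empty
      then show ?case by simp
    next
      case (Int a b)
      then obtain r s where rs: "cyl r (nb r p) \<subseteq> a" "cyl s (nb s p) \<subseteq> b" by blast
      have "cyl (max r s) (nb (max r s) p) \<subseteq> a \<inter> b"
        using rs own_cyl_antimono[OF p(1), of r "max r s"] own_cyl_antimono[OF p(1), of s "max r s"]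
        by auto
      then show ?case by blast
    next
      case (UN K)
      then show ?case by blast
    next
      case (Basis s)
      then show ?case using own_cyl_subset[OF p(1)] by blast
    qed
  qed
  then show "S \<subseteq> X // rel \<and> (\<forall>p\<in>X. cls p \<in> S \<longrightarrow> (\<exists>r. cyl r (nb r p) \<subseteq> S))"
    using openin_subset[OF S] unfolding topspace_cyl_top by blast
next
  assume *: "S \<subseteq> X // rel \<and> (\<forall>p\<in>X. cls p \<in> S \<longrightarrow> (\<exists>r. cyl r (nb r p) \<subseteq> S))"
  show "openin cyl_top S"
  proof (subst openin_subopen, intro ballI)
    fix A assume A: "A \<in> S"
    then obtain p where p: "p \<in> X" "A = cls p" using * by (blast elim: classes_cases)
    have "cls p \<in> S" using A p(2) by simp
    then obtain r where "cyl r (nb r p) \<subseteq> S" using * p(1) by blast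
    then show "\<exists>W. openin cyl_top W \<and> A \<in> W \<and> W \<subseteq> S"
      unfolding p(2) using cls_in_own_cyl[OF p(1)] openin_cyl by (intro exI conjI)
  qed
qed

text \<open>The complement of a cylinder is a union of cylinders of the same radius.\<close>

lemma closedin_cyl: "closedin cyl_top (cyl r U)"
  unfolding closedin_def topspace_cyl_top openin_cyl_top_iff
proof (intro conjI ballI impI)
  fix p assume p: "p \<in> X" "cls p \<in> X // rel - cyl r U"
  have "cyl r (nb r p) \<inter> cyl r U = {}"
  proof (rule ccontr)
    assume "\<not> ?thesis"
    then obtain A where A: "A \<in> cyl r (nb r p)" "A \<in> cyl r U" by blast
    obtain q where q: "q \<in> X" "A = cls q" using A cyl_subset by (blast elim: classes_cases)
    then have "iso (nb r q) (nb r p)" "iso (nb r q) U" using A by (simp_all add: cls_in_cyl)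
    then have "iso (nb r p) U"
      using iso_trans iso_sym good_nb X_imp_good q(1) by blast
    then show False using p by (simp add: cls_in_cyl)
  qed
  then show "\<exists>r'. cyl r' (nb r' p) \<subseteq> X // rel - cyl r U" using cyl_subset by blast
qed (use cyl_subset in auto)

definition base where "base = {cyl r (nb r p) | r p. p \<in> X}"

text \<open>Data that determine a rooted graph up to isomorphism: \<open>ends\<close> and the decoration are restricted to
actual edges. For a neighborhood in a locally finite graph the sets are finite, so neighborhoods have only
countably many codes.\<close>

definition code where
  "code p = (verts (fst p), edges (fst p), Sigma (edges (fst p)) (ends (fst p)),
     (\<lambda>e. (e, dec (fst p) e)) ` edges (fst p), snd p)"

lemma code_eq_imp_iso:
  assumes "code p = code q" shows "iso p q"
proof -
  have eq: "verts (fst p) = verts (fst q)" "edges (fst p) = edges (fst q)" "snd p = snd q"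
    and inc: "Sigma (edges (fst p)) (ends (fst p)) = Sigma (edges (fst q)) (ends (fst q))"
    and dec: "(\<lambda>e. (e, dec (fst p) e)) ` edges (fst p) = (\<lambda>e. (e, dec (fst q) e)) ` edges (fst q)"
    using assms unfolding code_def prod.inject by blast+
  have "ends (fst q) e = ends (fst p) e" if "e \<in> edges (fst p)" for e
  proof -
    have "v \<in> ends (fst q) e \<longleftrightarrow> v \<in> ends (fst p) e" for v
    proof -
      have "(e, v) \<in> Sigma (edges (fst p)) (ends (fst p)) \<longleftrightarrow>
          (e, v) \<in> Sigma (edges (fst q)) (ends (fst q))"
        unfolding inc by (rule refl)
      then show ?thesis using that eq(2) by simp
    qed
    then show ?thesis by blast
  qed
  moreover have "dec (fst q) e = dec (fst p) e" if "e \<in> edges (fst p)" for e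
  proof -
    have "(e, dec (fst p) e) \<in> (\<lambda>e. (e, dec (fst q) e)) ` edges (fst q)"
      unfolding dec[symmetric] using that by (rule imageI)
    then show ?thesis by auto
  qed
  ultimately show ?thesis
    unfolding iso_def using eq
    by (intro exI[of _ id]) (auto simp: graph_iso_def dec_preserving_def prod.map_id)
qed

lemma countable_cylinder_base: "countable base"
proof -
  let ?codes = "{S :: nat set. finite S} \<times> {S :: nat set. finite S} \<times> {S :: (nat \<times> nat) set. finite S} \<times>
    {S :: (nat \<times> nat list \<times> nat) set. finite S} \<times> (UNIV :: nat set)"
  have "countable ?codes" by (intro countable_SIGMA countable_Collect_finite countableI_type)
  have codes: "code (nb r p) \<in> ?codes" if p: "p \<in> X" for r p
  proof -
    have fin: "finite (verts (fst (nb r p)))" "finite (edges (fst (nb r p)))"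
      using finite_nbhd[of "fst p" "snd p" r] X_wf[of "fst p" "snd p"] X_root[of "fst p" "snd p"]
        X_locally_finite[of "fst p" "snd p"] p by (simp_all add: nb_def)
    have "wf_multigraph (fst (nb r p))" using good_nb[OF X_imp_good[OF p]] by (simp add: good_def)
    then have "finite (Sigma (edges (fst (nb r p))) (ends (fst (nb r p))))"
      using fin wf_ends_subset[of "fst (nb r p)"] by (intro finite_SigmaI) simp_all
    then show ?thesis using fin by (simp add: code_def)
  qed
  define rep where "rep r c = (SOME p. p \<in> X \<and> code (nb r p) = c)" for r c
  have "base \<subseteq> (\<lambda>(r, c). cyl r (nb r (rep r c))) ` (UNIV \<times> ?codes)"
  proof
    fix b assume "b \<in> base"
    then obtain r p where p: "p \<in> X" "b = cyl r (nb r p)" by (auto simp: base_def)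
    have rep: "rep r (code (nb r p)) \<in> X" "code (nb r (rep r (code (nb r p)))) = code (nb r p)"
      unfolding rep_def using someI[of "\<lambda>q. q \<in> X \<and> code (nb r q) = code (nb r p)" p] p by auto
    have "b = cyl r (nb r (rep r (code (nb r p))))"
      unfolding p(2)
      using own_cyl_subset[OF p(1)] own_cyl_subset[OF rep(1)] cls_in_cyl[OF p(1)] cls_in_cyl[OF rep(1)]
        code_eq_imp_iso[OF rep(2)] code_eq_imp_iso[OF rep(2)[symmetric]]
      by blast
    then show "b \<in> (\<lambda>(r, c). cyl r (nb r (rep r c))) ` (UNIV \<times> ?codes)"
      using codes[OF p(1)] by (intro image_eqI[of _ _ "(r, code (nb r p))"]) auto
  qed
  moreover have "countable (UNIV \<times> ?codes :: (nat \<times> _) set)"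
    by (rule countable_SIGMA[OF countableI_type \<open>countable ?codes\<close>])
  ultimately show ?thesis by (meson countable_image countable_subset)
qed

sublocale clopen_base cyl_top base
proof
  fix S A assume "openin cyl_top S" "A \<in> S"
  then show "\<exists>b\<in>base. A \<in> b \<and> b \<subseteq> S"
  proof -
    obtain p where p: "p \<in> X" "A = cls p"
      using \<open>openin cyl_top S\<close> \<open>A \<in> S\<close> unfolding openin_cyl_top_iff by (blast elim: classes_cases)
    have "cls p \<in> S" using \<open>A \<in> S\<close> p(2) by simp
    then obtain r where "cyl r (nb r p) \<subseteq> S"
      using \<open>openin cyl_top S\<close> p(1) unfolding openin_cyl_top_iff by blast
    moreover have "cyl r (nb r p) \<in> base" using p(1) unfolding base_def by blast
    ultimately show ?thesis unfolding p(2) using cls_in_own_cyl[OF p(1)] by (intro bexI conjI)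
  qed
next
  show "countable base" by (rule countable_cylinder_base)
next
  fix b assume "b \<in> base"
  then show "openin cyl_top b \<and> closedin cyl_top b"
    unfolding base_def using openin_cyl closedin_cyl by blast
qed

end

section \<open>Walks in Schreier graphs\<close>

text \<open>A letter \<open>(i, True)\<close> stands for the generator \<open>a\<^sub>i\<close> and \<open>(i, False)\<close> for its inverse; a word
acts on the vertices of a Schreier graph by walking along or against labeled edges.\<close>

definition letters :: "nat \<Rightarrow> (nat \<times> bool) set" where
  "letters n = {1..n} \<times> UNIV"

locale schreier_graph =
  fixes n :: nat and G :: "('v, 'e) schreier"
  assumes wf: "wf_multigraph G" and structure_n: "schreier_structure n G"
begin

definition out_edge :: "'v \<Rightarrow> nat \<Rightarrow> 'e" where
  "out_edge v i = (THE e. e \<in> edges G \<and> gen G e = i \<and> source G e = v)"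

definition in_edge :: "'v \<Rightarrow> nat \<Rightarrow> 'e" where
  "in_edge v i = (THE e. e \<in> edges G \<and> gen G e = i \<and> target G e = v)"

definition step :: "'v \<Rightarrow> nat \<times> bool \<Rightarrow> 'v" where
  "step v a = (if snd a then target G (out_edge v (fst a)) else source G (in_edge v (fst a)))"

definition walk :: "'v \<Rightarrow> (nat \<times> bool) list \<Rightarrow> 'v" where
  "walk x w = foldl step x w"

lemma ends_eq: "e \<in> edges G \<Longrightarrow> ends G e = {source G e, target G e}"
  and gen_range: "e \<in> edges G \<Longrightarrow> gen G e \<in> {1..n}"
  using structure_n by (auto simp: schreier_structure_def)

lemma source_in: "e \<in> edges G \<Longrightarrow> source G e \<in> verts G"
  and target_in: "e \<in> edges G \<Longrightarrow> target G e \<in> verts G"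
  using wf_ends_subset[OF wf] ends_eq by auto

lemma out_edge_unique: "v \<in> verts G \<Longrightarrow> i \<in> {1..n} \<Longrightarrow> \<exists>!e. e \<in> edges G \<and> gen G e = i \<and> source G e = v"
  and in_edge_unique: "v \<in> verts G \<Longrightarrow> i \<in> {1..n} \<Longrightarrow> \<exists>!e. e \<in> edges G \<and> gen G e = i \<and> target G e = v"
  using structure_n by (auto simp: schreier_structure_def)

lemma out_edge:
  assumes "v \<in> verts G" "i \<in> {1..n}"
  shows "out_edge v i \<in> edges G" "gen G (out_edge v i) = i" "source G (out_edge v i) = v"
  using theI'[OF out_edge_unique[OF assms]] by (simp_all add: out_edge_def)

lemma in_edge:
  assumes "v \<in> verts G" "i \<in> {1..n}"
  shows "in_edge v i \<in> edges G" "gen G (in_edge v i) = i" "target G (in_edge v i) = v"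
  using theI'[OF in_edge_unique[OF assms]] by (simp_all add: in_edge_def)

lemma out_edge_eqI: "e \<in> edges G \<Longrightarrow> out_edge (source G e) (gen G e) = e"
  unfolding out_edge_def
  by (rule the1_equality[OF out_edge_unique]) (simp_all add: source_in gen_range[simplified])

lemma in_edge_eqI: "e \<in> edges G \<Longrightarrow> in_edge (target G e) (gen G e) = e"
  unfolding in_edge_def
  by (rule the1_equality[OF in_edge_unique]) (simp_all add: target_in gen_range[simplified])

lemma step_source: "e \<in> edges G \<Longrightarrow> step (source G e) (gen G e, True) = target G e"
  and step_target: "e \<in> edges G \<Longrightarrow> step (target G e) (gen G e, False) = source G e"
  by (simp_all add: step_def out_edge_eqI in_edge_eqI)

lemma letter_cases:
  assumes v: "v \<in> verts G" and a: "a \<in> letters n"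
  obtains e where "e \<in> edges G" "v = source G e" "a = (gen G e, True)" "step v a = target G e"
  | e where "e \<in> edges G" "v = target G e" "a = (gen G e, False)" "step v a = source G e"
proof -
  obtain i b where ib: "a = (i, b)" "i \<in> {1..n}" using a by (auto simp: letters_def)
  show thesis
  proof (cases b)
    case True
    then show thesis
      using out_edge[OF v ib(2)] ib(1) that(1)[of "out_edge v i"] by (simp add: step_def)
  next
    case False
    then show thesis
      using in_edge[OF v ib(2)] ib(1) that(2)[of "in_edge v i"] by (simp add: step_def)
  qed
qed

lemma step_in: "v \<in> verts G \<Longrightarrow> a \<in> letters n \<Longrightarrow> step v a \<in> verts G"
  by (rule letter_cases[of v a]) (simp_all add: source_in target_in)

lemma step_inverse:
  assumes "v \<in> verts G" "(i, b) \<in> letters n"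
  shows "step (step v (i, b)) (i, \<not> b) = v"
  using assms by (rule letter_cases) (auto simp: step_source step_target)

lemma adj_iff_step:
  assumes u: "u \<in> verts G"
  shows "(u, v) \<in> adj G \<longleftrightarrow> (\<exists>a\<in>letters n. v = step u a)"
proof
  assume "(u, v) \<in> adj G"
  then obtain e where e: "e \<in> edges G" "ends G e = {u, v}" by (auto simp: adj_def)
  then have "u = source G e \<and> v = target G e \<or> u = target G e \<and> v = source G e"
    using ends_eq[OF e(1)] by (auto simp: doubleton_eq_iff)
  moreover have "(gen G e, b) \<in> letters n" for b using gen_range[OF e(1)] by (simp add: letters_def)
  ultimately show "\<exists>a\<in>letters n. v = step u a"
    using step_source[OF e(1)] step_target[OF e(1)] by metis
next
  assume "\<exists>a\<in>letters n. v = step u a"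
  then obtain a where a: "a \<in> letters n" "v = step u a" by blast
  from u a(1) show "(u, v) \<in> adj G"
    by (rule letter_cases) (auto simp: adj_def a(2) ends_eq insert_commute)
qed

lemma walk_simps [simp]: "walk x [] = x" "walk x (w @ [a]) = step (walk x w) a"
  by (simp_all add: walk_def)

lemma walk_in: "x \<in> verts G \<Longrightarrow> w \<in> lists (letters n) \<Longrightarrow> walk x w \<in> verts G"
  by (induction w rule: rev_induct) (auto intro: step_in)

lemma relpow_adj_iff_walk:
  assumes x: "x \<in> verts G"
  shows "(x, y) \<in> adj G ^^ k \<longleftrightarrow> (\<exists>w\<in>lists (letters n). length w = k \<and> y = walk x w)"
proof (induction k arbitrary: y)
  case (Suc k)
  have "(x, y) \<in> adj G ^^ Suc k \<longleftrightarrow>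
      (\<exists>w. w \<in> lists (letters n) \<and> length w = k \<and> (walk x w, y) \<in> adj G)"
    by (auto simp: relcomp_unfold Suc)
  also have "\<dots> \<longleftrightarrow> (\<exists>w a. w \<in> lists (letters n) \<and> length w = k \<and> a \<in> letters n \<and> y = step (walk x w) a)"
  proof -
    have "(walk x w, y) \<in> adj G \<longleftrightarrow> (\<exists>a\<in>letters n. y = step (walk x w) a)" if "w \<in> lists (letters n)" for w
      using adj_iff_step[OF walk_in[OF x that]] .
    then show ?thesis by blast
  qed
  also have "\<dots> \<longleftrightarrow> (\<exists>w\<in>lists (letters n). length w = Suc k \<and> y = walk x w)"
  proof
    assume "\<exists>w a. w \<in> lists (letters n) \<and> length w = k \<and> a \<in> letters n \<and> y = step (walk x w) a"
    then obtain w a where "w \<in> lists (letters n)" "length w = k" "a \<in> letters n" "y = step (walk x w) a"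
      by blast
    then show "\<exists>w\<in>lists (letters n). length w = Suc k \<and> y = walk x w"
      by (intro bexI[of _ "w @ [a]"]) simp_all
  next
    assume "\<exists>w\<in>lists (letters n). length w = Suc k \<and> y = walk x w"
    then obtain w' where w': "w' \<in> lists (letters n)" "length w' = Suc k" "y = walk x w'" by blast
    then obtain w a where "w' = w @ [a]" by (cases w' rule: rev_cases) auto
    then show "\<exists>w a. w \<in> lists (letters n) \<and> length w = k \<and> a \<in> letters n \<and> y = step (walk x w) a"
      using w' by (intro exI[of _ w] exI[of _ a]) simp
  qed
  finally show ?case .
qed auto

lemma ball_eq_walks:
  assumes "x \<in> verts G"
  shows "ball_verts G x r = walk x ` {w \<in> lists (letters n). length w \<le> r}"
  using walk_in[OF assms] by (auto simp: ball_verts_def relpow_adj_iff_walk[OF assms])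

lemma verts_eq_walks:
  assumes "connected_graph G" "x \<in> verts G"
  shows "verts G = walk x ` lists (letters n)"
proof
  show "verts G \<subseteq> walk x ` lists (letters n)"
  proof
    fix y assume "y \<in> verts G"
    then have "(x, y) \<in> (adj G)\<^sup>*" using assms by (simp add: connected_graph_def)
    then obtain k where "(x, y) \<in> adj G ^^ k" by (auto dest: rtrancl_imp_relpow)
    then show "y \<in> walk x ` lists (letters n)" by (auto simp: relpow_adj_iff_walk[OF assms(2)])
  qed
  show "walk x ` lists (letters n) \<subseteq> verts G" using walk_in[OF assms(2)] by auto
qed

lemma card_out_edges:
  assumes "v \<in> verts G"
  shows "finite {e \<in> edges G. source G e = v} \<and> card {e \<in> edges G. source G e = v} = n"
proof -
  have "bij_betw (out_edge v) {1..n} {e \<in> edges G. source G e = v}"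
  proof (rule bij_betwI[where g = "gen G"])
    show "out_edge v \<in> {1..n} \<rightarrow> {e \<in> edges G. source G e = v}"
      using out_edge(1,3)[OF assms] by (intro Pi_I CollectI conjI)
    show "gen G \<in> {e \<in> edges G. source G e = v} \<rightarrow> {1..n}"
      using gen_range by blast
    show "gen G (out_edge v i) = i" if "i \<in> {1..n}" for i
      using out_edge(2)[OF assms that] .
    show "out_edge v (gen G e) = e" if "e \<in> {e \<in> edges G. source G e = v}" for e
      using out_edge_eqI[of e] that by simp
  qed
  then show ?thesis
    using bij_betw_finite[of _ "{1..n}"] bij_betw_same_card[of _ "{1..n}"] by fastforce
qed

lemma card_in_edges:
  assumes "v \<in> verts G"
  shows "finite {e \<in> edges G. target G e = v} \<and> card {e \<in> edges G. target G e = v} = n"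
proof -
  have "bij_betw (in_edge v) {1..n} {e \<in> edges G. target G e = v}"
  proof (rule bij_betwI[where g = "gen G"])
    show "in_edge v \<in> {1..n} \<rightarrow> {e \<in> edges G. target G e = v}"
      using in_edge(1,3)[OF assms] by (intro Pi_I CollectI conjI)
    show "gen G \<in> {e \<in> edges G. target G e = v} \<rightarrow> {1..n}"
      using gen_range by blast
    show "gen G (in_edge v i) = i" if "i \<in> {1..n}" for i
      using in_edge(2)[OF assms that] .
    show "in_edge v (gen G e) = e" if "e \<in> {e \<in> edges G. target G e = v}" for e
      using in_edge_eqI[of e] that by simp
  qed
  then show ?thesis
    using bij_betw_finite[of _ "{1..n}"] bij_betw_same_card[of _ "{1..n}"] by fastforce
qed

text \<open>Each label contributes one outgoing and one incoming edge at every vertex.\<close>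

lemma regular: "regular (2 * n) G"
  unfolding regular_def
proof
  fix v assume v: "v \<in> verts G"
  have "{e \<in> edges G. v \<in> ends G e} = {e \<in> edges G. source G e = v} \<union> {e \<in> edges G. target G e = v}"
    using ends_eq by auto
  then have fin: "finite {e \<in> edges G. v \<in> ends G e}"
    using card_out_edges[OF v] card_in_edges[OF v] by simp
  moreover have "degree G v = 2 * n"
    using degree_eq_out_plus_in[OF fin, of "source G" "target G"] ends_eq
      card_out_edges[OF v] card_in_edges[OF v] by simp
  ultimately show "finite {e \<in> edges G. v \<in> ends G e} \<and> degree G v = 2 * n" by blast
qed

end

text \<open>A Schreier graph is determined by the pairs of words that lead from the root to the same vertex. The
local version is needed for continuity: with \<open>L\<close> the words of length at most \<open>r\<close> it compares
\<open>r\<close>-neighborhoods, and the words longer by one letter detect the edges between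
vertices at distance \<open>r\<close>. With \<open>L\<close> the set of all words it compares whole graphs.\<close>

lemma isomorphic_if_same_coincidences:
  fixes G :: "('v, 'e) schreier" and H :: "('w, 'f) schreier"
  assumes "schreier_graph n G" "schreier_graph n H"
    and x: "x \<in> verts G" and y: "y \<in> verts H"
    and L: "L \<subseteq> lists (letters n)" "[] \<in> L"
    and coinc: "\<And>u v. u \<in> L \<Longrightarrow> v \<in> L \<Longrightarrow>
      schreier_graph.walk G x u = schreier_graph.walk G x v \<longleftrightarrow>
      schreier_graph.walk H y u = schreier_graph.walk H y v"
    and coinc': "\<And>u v a. u \<in> L \<Longrightarrow> v \<in> L \<Longrightarrow> a \<in> letters n \<Longrightarrow>
      schreier_graph.walk G x (u @ [a]) = schreier_graph.walk G x v \<longleftrightarrow>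
      schreier_graph.walk H y (u @ [a]) = schreier_graph.walk H y v"
  obtains \<phi> \<psi> where
    "graph_iso \<phi> \<psi> (induced G (schreier_graph.walk G x ` L)) (induced H (schreier_graph.walk H y ` L))"
    and "\<And>e. e \<in> edges (induced G (schreier_graph.walk G x ` L)) \<Longrightarrow>
      source H (\<psi> e) = \<phi> (source G e) \<and> target H (\<psi> e) = \<phi> (target G e) \<and> gen H (\<psi> e) = gen G e"
    and "\<phi> x = y"
proof -
  interpret G: schreier_graph n G by fact
  interpret H: schreier_graph n H by fact
  define VG where "VG = G.walk x ` L"
  define VH where "VH = H.walk y ` L"
  have VG: "VG \<subseteq> verts G" using G.walk_in[OF x] L(1) by (auto simp: VG_def)
  have VH: "VH \<subseteq> verts H" using H.walk_in[OF y] L(1) by (auto simp: VH_def)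
  \<comment> \<open>The end of a walk in \<open>G\<close> goes to the end of the same walk in \<open>H\<close>, whichever of the words
    that reach it is chosen.\<close>
  define \<phi> where "\<phi> v = H.walk y (SOME u. u \<in> L \<and> G.walk x u = v)" for v
  have \<phi>: "\<phi> (G.walk x u) = H.walk y u" if u: "u \<in> L" for u
  proof -
    define u' where "u' = (SOME u'. u' \<in> L \<and> G.walk x u' = G.walk x u)"
    have "u' \<in> L \<and> G.walk x u' = G.walk x u"
      unfolding u'_def by (rule someI[of _ u]) (simp add: u)
    then have "H.walk y u' = H.walk y u" using coinc u by blast
    then show ?thesis by (simp add: \<phi>_def u'_def)
  qed
  have inj: "inj_on \<phi> VG"
  proof (rule inj_onI)
    fix a b assume ab: "a \<in> VG" "b \<in> VG" "\<phi> a = \<phi> b"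
    then obtain u v where uv: "u \<in> L" "v \<in> L" "a = G.walk x u" "b = G.walk x v" by (auto simp: VG_def)
    then have "H.walk y u = H.walk y v" using ab(3) \<phi> by simp
    then show "a = b" using coinc[OF uv(1,2)] uv(3,4) by simp
  qed
  have img: "\<phi> ` VG = VH" by (auto simp: VG_def VH_def \<phi> image_image)
  \<comment> \<open>An edge of a Schreier graph is determined by its source and its label.\<close>
  define \<psi> where "\<psi> e = H.out_edge (\<phi> (source G e)) (gen G e)" for e
  let ?EG = "{e \<in> edges G. ends G e \<subseteq> VG}" and ?EH = "{f \<in> edges H. ends H f \<subseteq> VH}"
  have letter: "(i, True) \<in> letters n" if "i \<in> {1..n}" for i using that by (simp add: letters_def)
  have \<psi>: "\<psi> e \<in> ?EH \<and> source H (\<psi> e) = \<phi> (source G e) \<and> target H (\<psi> e) = \<phi> (target G e) \<and>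
      gen H (\<psi> e) = gen G e" if e: "e \<in> ?EG" for e
  proof -
    have eE: "e \<in> edges G" and "source G e \<in> VG" "target G e \<in> VG" using e G.ends_eq[of e] by auto
    then obtain u v where uv: "u \<in> L" "v \<in> L" "source G e = G.walk x u" "target G e = G.walk x v"
      by (auto simp: VG_def)
    have i: "gen G e \<in> {1..n}" using G.gen_range[OF eE] .
    have "G.walk x (u @ [(gen G e, True)]) = G.walk x v"
      using G.step_source[OF eE] uv by simp
    then have w: "H.walk y (u @ [(gen G e, True)]) = H.walk y v"
      using coinc'[OF uv(1,2) letter[OF i]] by blast
    have uH: "H.walk y u \<in> verts H" using VH uv(1) by (auto simp: VH_def)
    have \<psi>e: "\<psi> e = H.out_edge (H.walk y u) (gen G e)" using uv \<phi> by (simp add: \<psi>_def)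
    note f = H.out_edge[OF uH i, folded \<psi>e]
    have tgt: "target H (\<psi> e) = H.walk y v"
      using w H.step_source[OF f(1)] f(2,3) by simp
    have "ends H (\<psi> e) \<subseteq> VH"
      using H.ends_eq[OF f(1)] f(3) tgt uv(1,2) by (auto simp: VH_def)
    then show ?thesis using f tgt uv \<phi> by simp
  qed
  have "inj_on \<psi> ?EG"
  proof (rule inj_onI)
    fix e e' assume e: "e \<in> ?EG" "e' \<in> ?EG" "\<psi> e = \<psi> e'"
    have eE: "e \<in> edges G" "e' \<in> edges G" using e by auto
    have eq: "\<phi> (source G e) = \<phi> (source G e')" "gen G e = gen G e'"
      using \<psi>[OF e(1)] \<psi>[OF e(2)] e(3) by simp_all
    have "source G e \<in> VG" "source G e' \<in> VG" using e G.ends_eq by auto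
    with eq(1) have "source G e = source G e'" by (rule inj_onD[OF inj])
    then have "G.out_edge (source G e) (gen G e) = G.out_edge (source G e') (gen G e')"
      using eq(2) by (rule arg_cong2)
    then show "e = e'" unfolding G.out_edge_eqI[OF eE(1)] G.out_edge_eqI[OF eE(2)] .
  qed
  moreover have "\<psi> ` ?EG = ?EH"
  proof (intro equalityI subsetI)
    fix f assume f: "f \<in> ?EH"
    then have fE: "f \<in> edges H" and "source H f \<in> VH" "target H f \<in> VH" using H.ends_eq[of f] by auto
    then obtain u v where uv: "u \<in> L" "v \<in> L" "source H f = H.walk y u" "target H f = H.walk y v"
      by (auto simp: VH_def)
    have i: "gen H f \<in> {1..n}" using H.gen_range[OF fE] .
    have "H.walk y (u @ [(gen H f, True)]) = H.walk y v"
      using H.step_source[OF fE] uv by simp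
    then have w: "G.walk x (u @ [(gen H f, True)]) = G.walk x v"
      using coinc'[OF uv(1,2) letter[OF i]] by blast
    have uG: "G.walk x u \<in> verts G" using VG uv(1) by (auto simp: VG_def)
    define e where "e = G.out_edge (G.walk x u) (gen H f)"
    note e = G.out_edge[OF uG i, folded e_def]
    have "target G e = G.walk x v" using w G.step_source[OF e(1)] e(2,3) by simp
    then have "e \<in> ?EG" using G.ends_eq[OF e(1)] e uv(1,2) by (auto simp: VG_def)
    moreover have "\<psi> e = f"
      using H.out_edge_eqI[OF fE] e uv \<phi> by (simp add: \<psi>_def)
    ultimately show "f \<in> \<psi> ` ?EG" by blast
  qed (use \<psi> in blast)
  moreover have "ends H (\<psi> e) = \<phi> ` ends G e" if "e \<in> ?EG" for e
    using \<psi>[OF that] that G.ends_eq[of e] H.ends_eq[of "\<psi> e"] by simp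
  ultimately have "graph_iso \<phi> \<psi> (induced G VG) (induced H VH)"
    using inj img by (simp add: graph_iso_def bij_betw_def)
  moreover have "\<phi> x = y" using \<phi>[OF L(2)] by simp
  ultimately show thesis using that[of \<phi> \<psi>] \<psi> unfolding VG_def VH_def by simp
qed

section \<open>Schreier graphs built from relations on words\<close>

definition flip :: "nat \<times> bool \<Rightarrow> nat \<times> bool" where
  "flip a = (fst a, \<not> snd a)"

type_synonym word_rel = "(nat \<times> bool) list \<times> (nat \<times> bool) list \<Rightarrow> bool"

text \<open>The relation "\<open>u\<close> and \<open>v\<close> lead from the root to the same vertex" is an equivalence relation, invariant under
appending letters and compatible with cancellation. For the coset graph of a subgroup \<open>H\<close> of the free
group it says that \<open>u\<close> and \<open>v\<close> represent the same coset of \<open>H\<close>. Conversely every such relation comes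
from a Schreier graph, whose vertices are its classes. Each of the conditions involves only
finitely many values of \<open>E\<close>, so they define a closed set of relations.\<close>

definition coset_relations :: "nat \<Rightarrow> word_rel set" where
  "coset_relations n = {E.
     (\<forall>u\<in>lists (letters n). E (u, u)) \<and>
     (\<forall>u\<in>lists (letters n). \<forall>v\<in>lists (letters n). E (u, v) \<longrightarrow> E (v, u)) \<and>
     (\<forall>u\<in>lists (letters n). \<forall>v\<in>lists (letters n). \<forall>w\<in>lists (letters n).
        E (u, v) \<longrightarrow> E (v, w) \<longrightarrow> E (u, w)) \<and>
     (\<forall>u\<in>lists (letters n). \<forall>v\<in>lists (letters n). \<forall>a\<in>letters n.
        E (u, v) \<longrightarrow> E (u @ [a], v @ [a])) \<and>
     (\<forall>u\<in>lists (letters n). \<forall>a\<in>letters n. E (u @ [a, flip a], u))}"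

lemma flip_in_letters: "a \<in> letters n \<Longrightarrow> flip a \<in> letters n"
  by (auto simp: letters_def flip_def)

locale coset_relation =
  fixes n :: nat and E :: word_rel
  assumes E: "E \<in> coset_relations n"
begin

abbreviation W :: "(nat \<times> bool) list set" where "W \<equiv> lists (letters n)"

lemma E_refl: "u \<in> W \<Longrightarrow> E (u, u)"
  and E_sym: "u \<in> W \<Longrightarrow> v \<in> W \<Longrightarrow> E (u, v) \<Longrightarrow> E (v, u)"
  and E_trans: "u \<in> W \<Longrightarrow> v \<in> W \<Longrightarrow> w \<in> W \<Longrightarrow> E (u, v) \<Longrightarrow> E (v, w) \<Longrightarrow> E (u, w)"
  and E_append: "u \<in> W \<Longrightarrow> v \<in> W \<Longrightarrow> a \<in> letters n \<Longrightarrow> E (u, v) \<Longrightarrow> E (u @ [a], v @ [a])"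
  and E_cancel: "u \<in> W \<Longrightarrow> a \<in> letters n \<Longrightarrow> E (u @ [a, flip a], u)"
  using E unfolding coset_relations_def by blast+

text \<open>The class of a word, represented by a natural number so that the graph has type
\<open>(nat, nat) schreier\<close>.\<close>

definition coset :: "(nat \<times> bool) list \<Rightarrow> nat" where
  "coset u = (LEAST k. \<exists>v\<in>W. E (u, v) \<and> to_nat v = k)"

lemma coset_eq_iff:
  assumes u: "u \<in> W" and v: "v \<in> W"
  shows "coset u = coset v \<longleftrightarrow> E (u, v)"
proof
  assume eq: "coset u = coset v"
  have attained: "\<exists>u'\<in>W. E (u, u') \<and> to_nat u' = coset u" if "u \<in> W" for u
    unfolding coset_def by (rule LeastI[of _ "to_nat u"]) (use E_refl that in blast)
  obtain u' v' where u': "u' \<in> W" "E (u, u')" "to_nat u' = coset u"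
    and v': "v' \<in> W" "E (v, v')" "to_nat v' = coset v"
    using attained[OF u] attained[OF v] by blast
  have "to_nat u' = to_nat v'" using u'(3) v'(3) eq by simp
  then have "u' = v'" by (simp only: to_nat_split inj_eq[OF inj_to_nat])
  then show "E (u, v)" using E_trans[OF u u'(1) v u'(2)] E_sym[OF v v'(1,2)] by simp
next
  assume uv: "E (u, v)"
  have "E (u, w) \<longleftrightarrow> E (v, w)" if "w \<in> W" for w
    using E_trans[OF u v that uv] E_trans[OF v u that E_sym[OF u v uv]] by blast
  then have "(\<lambda>k. \<exists>w\<in>W. E (u, w) \<and> to_nat w = k) = (\<lambda>k. \<exists>w\<in>W. E (v, w) \<and> to_nat w = k)"
    by blast
  then show "coset u = coset v" unfolding coset_def by (rule arg_cong)
qed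

lemma append_in_W: "u \<in> W \<Longrightarrow> a \<in> letters n \<Longrightarrow> u @ [a] \<in> W"
  by simp

lemma coset_append_cong:
  assumes "u \<in> W" "v \<in> W" "a \<in> letters n" "coset u = coset v"
  shows "coset (u @ [a]) = coset (v @ [a])"
  using assms E_append by (simp add: coset_eq_iff append_in_W)

lemma coset_cancel:
  assumes "u \<in> W" "a \<in> letters n"
  shows "coset (u @ [a, flip a]) = coset u"
  using assms E_cancel flip_in_letters by (simp add: coset_eq_iff)

definition representative :: "nat \<Rightarrow> (nat \<times> bool) list" where
  "representative k = (SOME u. u \<in> W \<and> coset u = k)"

lemma representative:
  assumes "k \<in> coset ` W"
  shows "representative k \<in> W" "coset (representative k) = k"
proof -
  have "\<exists>u. u \<in> W \<and> coset u = k" using assms by auto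
  from someI_ex[OF this] show "representative k \<in> W" "coset (representative k) = k"
    by (simp_all only: representative_def)
qed

text \<open>The edge labeled \<open>i\<close> that leaves the vertex \<open>k\<close> is the number \<open>prod_encode (k, i)\<close>.\<close>

definition edge_target :: "nat \<Rightarrow> nat" where
  "edge_target e = coset (representative (fst (prod_decode e)) @ [(snd (prod_decode e), True)])"

definition coset_graph :: "(nat, nat) schreier" where
  "coset_graph = \<lparr>verts = coset ` W, edges = prod_encode ` (coset ` W \<times> {1..n}),
     ends = (\<lambda>e. {fst (prod_decode e), edge_target e}),
     source = (\<lambda>e. fst (prod_decode e)), target = edge_target, gen = (\<lambda>e. snd (prod_decode e))\<rparr>"

lemma coset_graph_simps:
  "verts coset_graph = coset ` W" "edges coset_graph = prod_encode ` (coset ` W \<times> {1..n})"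
  "ends coset_graph e = {source coset_graph e, target coset_graph e}"
  "source coset_graph (prod_encode (k, i)) = k" "gen coset_graph (prod_encode (k, i)) = i"
  by (simp_all add: coset_graph_def)

lemma coset_graph_edge_cases:
  assumes "e \<in> edges coset_graph"
  obtains u i where "u \<in> W" "i \<in> {1..n}" "e = prod_encode (coset u, i)"
  using assms unfolding coset_graph_simps by blast

lemma target_coset_graph:
  assumes "u \<in> W" "i \<in> {1..n}"
  shows "target coset_graph (prod_encode (coset u, i)) = coset (u @ [(i, True)])"
proof -
  have "coset u \<in> coset ` W" using assms by blast
  then have "coset (representative (coset u) @ [(i, True)]) = coset (u @ [(i, True)])"
    using assms by (intro coset_append_cong representative) (simp_all add: letters_def)
  then show ?thesis by (simp add: coset_graph_def edge_target_def)
qed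

lemma edge_in_coset_graph:
  "u \<in> W \<Longrightarrow> i \<in> {1..n} \<Longrightarrow> prod_encode (coset u, i) \<in> edges coset_graph"
  unfolding coset_graph_simps by (intro imageI SigmaI)

lemma letter: "i \<in> {1..n} \<Longrightarrow> (i, b) \<in> letters n"
  by (simp add: letters_def)

lemma incoming_coset_edge_iff:
  assumes "u \<in> W" "v \<in> W" "i \<in> {1..n}"
  shows "coset (v @ [(i, True)]) = coset u \<longleftrightarrow> coset v = coset (u @ [(i, False)])"
proof
  assume "coset (v @ [(i, True)]) = coset u"
  then have "coset ((v @ [(i, True)]) @ [(i, False)]) = coset (u @ [(i, False)])"
    using assms letter by (intro coset_append_cong append_in_W)
  then show "coset v = coset (u @ [(i, False)])"
    using coset_cancel[OF assms(2) letter[OF assms(3)], of True] by (simp add: flip_def)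
next
  assume "coset v = coset (u @ [(i, False)])"
  then have "coset (v @ [(i, True)]) = coset ((u @ [(i, False)]) @ [(i, True)])"
    using assms letter by (intro coset_append_cong append_in_W)
  then show "coset (v @ [(i, True)]) = coset u"
    using coset_cancel[OF assms(1) letter[OF assms(3)], of False] by (simp add: flip_def)
qed

lemma schreier_coset_graph: "schreier_graph n coset_graph"
proof
  show "wf_multigraph coset_graph"
    unfolding wf_multigraph_def
  proof
    fix e assume "e \<in> edges coset_graph"
    then obtain u i where ui: "u \<in> W" "i \<in> {1..n}" "e = prod_encode (coset u, i)"
      by (rule coset_graph_edge_cases)
    then have "source coset_graph e \<in> verts coset_graph" "target coset_graph e \<in> verts coset_graph"
      using target_coset_graph[OF ui(1,2)] append_in_W[OF ui(1) letter[OF ui(2)]]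
      by (simp_all only: coset_graph_simps ui(3)) blast+
    then show "\<exists>u\<in>verts coset_graph. \<exists>v\<in>verts coset_graph. ends coset_graph e = {u, v}"
      using coset_graph_simps(3) by blast
  qed
  show "schreier_structure n coset_graph"
    unfolding schreier_structure_def
  proof (intro conjI ballI)
    fix e assume "e \<in> edges coset_graph"
    then show "gen coset_graph e \<in> {1..n}"
      by (rule coset_graph_edge_cases) (simp only: coset_graph_simps)
    show "ends coset_graph e = {source coset_graph e, target coset_graph e}"
      by (rule coset_graph_simps(3))
  next
    fix x i assume "x \<in> verts coset_graph" and i: "i \<in> {1..n}"
    then obtain u where u: "u \<in> W" "x = coset u" unfolding coset_graph_simps by blast
    show "\<exists>!e. e \<in> edges coset_graph \<and> gen coset_graph e = i \<and> source coset_graph e = x"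
    proof (rule ex1I[of _ "prod_encode (coset u, i)"])
      fix e assume e: "e \<in> edges coset_graph \<and> gen coset_graph e = i \<and> source coset_graph e = x"
      then have "e \<in> edges coset_graph" by blast
      then obtain v j where "v \<in> W" "j \<in> {1..n}" "e = prod_encode (coset v, j)"
        by (rule coset_graph_edge_cases)
      then show "e = prod_encode (coset u, i)" using e u(2) by (simp add: coset_graph_simps(4,5))
    qed (use u i edge_in_coset_graph in \<open>simp add: coset_graph_simps(4,5)\<close>)
    have uF: "u @ [(i, False)] \<in> W" using append_in_W[OF u(1) letter[OF i]] .
    show "\<exists>!e. e \<in> edges coset_graph \<and> gen coset_graph e = i \<and> target coset_graph e = x"
    proof (rule ex1I[of _ "prod_encode (coset (u @ [(i, False)]), i)"])
      have "target coset_graph (prod_encode (coset (u @ [(i, False)]), i)) = coset u"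
        using target_coset_graph[OF uF i] incoming_coset_edge_iff[OF u(1) uF i] by simp
      then show "prod_encode (coset (u @ [(i, False)]), i) \<in> edges coset_graph \<and>
          gen coset_graph (prod_encode (coset (u @ [(i, False)]), i)) = i \<and>
          target coset_graph (prod_encode (coset (u @ [(i, False)]), i)) = x"
        using u(2) edge_in_coset_graph[OF uF i] by (simp add: coset_graph_simps(5))
    next
      fix e assume e: "e \<in> edges coset_graph \<and> gen coset_graph e = i \<and> target coset_graph e = x"
      then have "e \<in> edges coset_graph" by blast
      then obtain v j where v: "v \<in> W" "j \<in> {1..n}" "e = prod_encode (coset v, j)"
        by (rule coset_graph_edge_cases)
      then have "j = i" using e by (simp add: coset_graph_simps(5))
      moreover have "coset (v @ [(j, True)]) = coset u"
        using e u(2) target_coset_graph[OF v(1,2)] v(3) by simp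
      ultimately show "e = prod_encode (coset (u @ [(i, False)]), i)"
        using incoming_coset_edge_iff[OF u(1) v(1) i] v(3) by simp
    qed
  qed
qed

sublocale cg: schreier_graph n coset_graph by (rule schreier_coset_graph)

lemma step_coset:
  assumes u: "u \<in> W" and a: "a \<in> letters n"
  shows "cg.step (coset u) a = coset (u @ [a])"
proof -
  obtain i b where ib: "a = (i, b)" "i \<in> {1..n}" using a by (auto simp: letters_def)
  show ?thesis
  proof (cases b)
    case True
    then show ?thesis
      using cg.step_source[OF edge_in_coset_graph[OF u ib(2)]] target_coset_graph[OF u ib(2)] ib(1)
      by (simp add: coset_graph_simps(4,5))
  next
    case False
    have uF: "u @ [(i, False)] \<in> W" using append_in_W[OF u letter[OF ib(2)]] .
    have "target coset_graph (prod_encode (coset (u @ [(i, False)]), i)) = coset u"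
      using target_coset_graph[OF uF ib(2)] incoming_coset_edge_iff[OF u uF ib(2)] by simp
    then show ?thesis
      using cg.step_target[OF edge_in_coset_graph[OF uF ib(2)]] ib(1) False
      by (simp add: coset_graph_simps(4,5))
  qed
qed

text \<open>The coincidences of walks in the coset graph are those prescribed by \<open>E\<close>.\<close>

lemma walk_coset: "w \<in> W \<Longrightarrow> cg.walk (coset []) w = coset w"
  by (induction w rule: rev_induct) (auto simp: step_coset)

lemma root_in_coset_graph: "coset [] \<in> verts coset_graph"
  unfolding coset_graph_simps by (rule imageI) simp

lemma connected_coset_graph: "connected_graph coset_graph"
  unfolding connected_graph_def
proof (intro ballI)
  have reach: "(coset [], x) \<in> (adj coset_graph)\<^sup>*" if "x \<in> verts coset_graph" for x
  proof -
    obtain w where "w \<in> W" "x = coset w" using \<open>x \<in> verts coset_graph\<close> unfolding coset_graph_simps by blast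
    then have "(coset [], x) \<in> adj coset_graph ^^ length w"
      using cg.relpow_adj_iff_walk[OF root_in_coset_graph] walk_coset by metis
    then show ?thesis by (rule relpow_imp_rtrancl)
  qed
  have "sym (adj coset_graph)" by (auto simp: sym_def adj_def insert_commute)
  then have sym: "sym ((adj coset_graph)\<^sup>*)" by (rule sym_rtrancl)
  fix x y assume "x \<in> verts coset_graph" "y \<in> verts coset_graph"
  then show "(x, y) \<in> (adj coset_graph)\<^sup>*"
    using reach symD[OF sym] by (meson rtrancl_trans)
qed

lemma coset_graph_in: "(coset_graph, coset []) \<in> schreier_graphs n"
  using cg.wf cg.regular connected_coset_graph cg.structure_n root_in_coset_graph
  by (simp add: schreier_graphs_def)

end

lemma (in schreier_graph) coincidences_in_coset_relations:
  assumes x: "x \<in> verts G"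
  shows "(\<lambda>(u, v). walk x u = walk x v) \<in> coset_relations n"
proof -
  have "walk x (u @ [a, flip a]) = walk x u" if u: "u \<in> lists (letters n)" and a: "a \<in> letters n" for u a
  proof -
    have "walk x ((u @ [a]) @ [flip a]) = walk x u"
      using step_inverse[OF walk_in[OF x u], of "fst a" "snd a"] a
      by (simp only: walk_simps flip_def prod.collapse)
    then show ?thesis by simp
  qed
  then show ?thesis unfolding coset_relations_def by simp
qed

section \<open>The spaces of rooted regular graphs and of Schreier graphs\<close>

text \<open>The decoration that makes the isomorphisms of decorated graphs the isomorphisms of Schreier
graphs.\<close>

definition edge_labels :: "(nat, nat) schreier \<Rightarrow> nat \<Rightarrow> nat list \<times> nat" where
  "edge_labels G e = ([source G e, target G e], gen G e)"

interpretation Om: decorated_graphs "rooted_graphs n" "\<lambda>_ _. ([], 0)" for n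
  by unfold_locales (auto simp: rooted_graphs_def regular_def locally_finite_def)

interpretation La: decorated_graphs "schreier_graphs n" edge_labels for n
proof
  fix G :: "(nat, nat) schreier" and W
  show "edge_labels (induced G W) = edge_labels G"
    by (simp add: edge_labels_def induced_def fun_eq_iff)
next
  fix G :: "(nat, nat) schreier" and x e
  assume "(G, x) \<in> schreier_graphs n" "e \<in> edges G"
  then show "set (fst (edge_labels G e)) \<subseteq> ends G e"
    by (simp add: schreier_graphs_def schreier_structure_def edge_labels_def)
qed (auto simp: schreier_graphs_def regular_def locally_finite_def)

lemma rooted_iso_eq: "rooted_iso p q \<longleftrightarrow> Om.iso p q"
  by (auto simp: rooted_iso_def Om.iso_def graph_iso_def Om.dec_preserving_def split: prod.splits)

lemma schreier_iso_eq: "schreier_iso p q \<longleftrightarrow> La.iso p q"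
proof -
  obtain G x H y where pq: "p = (G, x)" "q = (H, y)" by (metis surj_pair)
  have "La.dec_preserving \<phi> \<psi> G H \<longleftrightarrow> (\<forall>e\<in>edges G. source H (\<psi> e) = \<phi> (source G e) \<and>
      target H (\<psi> e) = \<phi> (target G e) \<and> gen H (\<psi> e) = gen G e)" for \<phi> \<psi>
    by (simp add: La.dec_preserving_def edge_labels_def)
  then show ?thesis
    unfolding schreier_iso_def La.iso_def pq prod.case fst_conv snd_conv graph_iso_def
    by (intro ex_cong1) blast
qed

lemma Omega_rel_eq: "Omega_rel n = Om.rel n"
  by (simp add: Omega_rel_def Om.rel_def rooted_iso_eq)

lemma Lambda_rel_eq: "Lambda_rel n = La.rel n"
  by (simp add: Lambda_rel_def La.rel_def schreier_iso_eq)

lemma Omega_eq: "Omega n = rooted_graphs n // Om.rel n"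
  by (simp add: Omega_def Omega_rel_eq)

lemma Lambda_eq: "Lambda n = schreier_graphs n // La.rel n"
  by (simp add: Lambda_def Lambda_rel_eq)

lemma Omega_top_eq: "Omega_top n = Om.cyl_top n"
proof -
  have "Omega_cylinder n r U = Om.cyl n r U" for r U
    by (simp add: Omega_cylinder_def Om.cyl_def Omega_eq rooted_iso_eq Om.nb_def case_prod_beta)
  then show ?thesis by (simp add: Omega_top_def Om.cyl_top_def)
qed

lemma Lambda_top_eq: "Lambda_top n = La.cyl_top n"
proof -
  have "Lambda_cylinder n r U = La.cyl n r U" for r U
    by (simp add: Lambda_cylinder_def La.cyl_def Lambda_eq schreier_iso_eq La.nb_def case_prod_beta)
  then show ?thesis by (simp add: Lambda_top_def La.cyl_top_def)
qed

lemma schreier_graphsD: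
  assumes "(G, x) \<in> schreier_graphs n"
  shows "schreier_graph n G" "connected_graph G" "x \<in> verts G"
  using assms by (simp_all add: schreier_graphs_def schreier_graph_def)

lemma induced_verts: "wf_multigraph G \<Longrightarrow> induced G (verts G) = G"
proof -
  assume "wf_multigraph G"
  from wf_ends_subset[OF this] have "{e \<in> edges G. ends G e \<subseteq> verts G} = edges G" by blast
  then show ?thesis by (simp add: induced_def)
qed

lemma La_iso_if_same_coincidences:
  assumes p: "(G, x) \<in> schreier_graphs n" and q: "(H, y) \<in> schreier_graphs n"
    and L: "L \<subseteq> lists (letters n)" "[] \<in> L"
    and same: "\<And>u v. u \<in> L \<union> (\<lambda>(u, a). u @ [a]) ` (L \<times> letters n) \<Longrightarrow> v \<in> L \<Longrightarrow>
      schreier_graph.walk G x u = schreier_graph.walk G x v \<longleftrightarrow>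
      schreier_graph.walk H y u = schreier_graph.walk H y v"
  shows "La.iso (induced G (schreier_graph.walk G x ` L), x) (induced H (schreier_graph.walk H y ` L), y)"
proof -
  have same': "schreier_graph.walk G x u = schreier_graph.walk G x v \<longleftrightarrow>
      schreier_graph.walk H y u = schreier_graph.walk H y v" if "u \<in> L" "v \<in> L" for u v
    using that by (intro same UnI1)
  have same'': "schreier_graph.walk G x (u @ [a]) = schreier_graph.walk G x v \<longleftrightarrow>
      schreier_graph.walk H y (u @ [a]) = schreier_graph.walk H y v"
    if "u \<in> L" "v \<in> L" "a \<in> letters n" for u v a
    using that by (intro same UnI2) (auto intro!: image_eqI[of _ _ "(u, a)"])
  obtain \<phi> \<psi> where iso:
    "graph_iso \<phi> \<psi> (induced G (schreier_graph.walk G x ` L)) (induced H (schreier_graph.walk H y ` L))"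
    and lab: "\<And>e. e \<in> edges (induced G (schreier_graph.walk G x ` L)) \<Longrightarrow>
      source H (\<psi> e) = \<phi> (source G e) \<and> target H (\<psi> e) = \<phi> (target G e) \<and> gen H (\<psi> e) = gen G e"
    and root: "\<phi> x = y"
    using isomorphic_if_same_coincidences[OF schreier_graphsD(1)[OF p] schreier_graphsD(1)[OF q]
        schreier_graphsD(3)[OF p] schreier_graphsD(3)[OF q] L same' same''] by blast
  have "La.dec_preserving \<phi> \<psi> (induced G (schreier_graph.walk G x ` L)) (induced H (schreier_graph.walk H y ` L))"
    unfolding La.dec_preserving_def La.dec_induced using lab by (simp add: edge_labels_def)
  then show ?thesis unfolding La.iso_def using iso root by (intro exI[of _ \<phi>] exI[of _ \<psi>]) simp
qed

section \<open>Compactness of the space of Schreier graphs\<close>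

text \<open>The space of all relations on words is a product of two-point spaces, hence compact by Tychonoff's
theorem. The coset relations form a closed subset, and sending such a relation to the class
of its coset graph is continuous and onto.\<close>

abbreviation rel_top :: "word_rel topology" where
  "rel_top \<equiv> product_topology (\<lambda>_. discrete_topology UNIV) UNIV"

lemma topspace_rel_top: "topspace rel_top = UNIV"
  by simp

lemma openin_coordinate: "openin rel_top {E. E p = b}"
proof -
  have "openin rel_top {E \<in> topspace rel_top. E p \<in> {b}}"
    by (rule openin_continuous_map_preimage[OF continuous_map_product_projection]) auto
  then show ?thesis by simp
qed

lemma openin_ex: "(\<And>i. i \<in> I \<Longrightarrow> openin rel_top {E. P i E}) \<Longrightarrow> openin rel_top {E. \<exists>i\<in>I. P i E}"
proof -
  assume "\<And>i. i \<in> I \<Longrightarrow> openin rel_top {E. P i E}"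
  then have "openin rel_top (\<Union>i\<in>I. {E. P i E})" by (intro openin_Union) blast
  moreover have "(\<Union>i\<in>I. {E. P i E}) = {E. \<exists>i\<in>I. P i E}" by blast
  ultimately show ?thesis by simp
qed

lemma openin_conj: "openin rel_top {E. P E} \<Longrightarrow> openin rel_top {E. Q E} \<Longrightarrow> openin rel_top {E. P E \<and> Q E}"
  by (simp add: Collect_conj_eq openin_Int)

lemma openin_disj: "openin rel_top {E. P E} \<Longrightarrow> openin rel_top {E. Q E} \<Longrightarrow> openin rel_top {E. P E \<or> Q E}"
  by (simp add: Collect_disj_eq openin_Un)

lemma closedin_coset_relations: "closedin rel_top (coset_relations n)"
proof -
  have pos: "openin rel_top {E. E p}" and neg: "openin rel_top {E. \<not> E p}" for p
    using openin_coordinate[of p True] openin_coordinate[of p False] by simp_all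
  have "UNIV - coset_relations n = {E.
     (\<exists>u\<in>lists (letters n). \<not> E (u, u)) \<or>
     (\<exists>u\<in>lists (letters n). \<exists>v\<in>lists (letters n). E (u, v) \<and> \<not> E (v, u)) \<or>
     (\<exists>u\<in>lists (letters n). \<exists>v\<in>lists (letters n). \<exists>w\<in>lists (letters n).
        E (u, v) \<and> E (v, w) \<and> \<not> E (u, w)) \<or>
     (\<exists>u\<in>lists (letters n). \<exists>v\<in>lists (letters n). \<exists>a\<in>letters n.
        E (u, v) \<and> \<not> E (u @ [a], v @ [a])) \<or>
     (\<exists>u\<in>lists (letters n). \<exists>a\<in>letters n. \<not> E (u @ [a, flip a], u))}"
    unfolding coset_relations_def by blast
  moreover have "openin rel_top \<dots>"
    by (intro openin_disj openin_ex openin_conj pos neg)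
  ultimately show ?thesis unfolding closedin_def topspace_rel_top by simp
qed

lemma openin_agreeing:
  assumes "finite I" shows "openin rel_top {E. \<forall>p\<in>I. E p = E\<^sub>0 p}"
  using assms
proof induction
  case (insert p I)
  have "openin rel_top ({E. E p = E\<^sub>0 p} \<inter> {E. \<forall>p\<in>I. E p = E\<^sub>0 p})"
    using openin_coordinate insert.IH by (rule openin_Int)
  moreover have "{E. E p = E\<^sub>0 p} \<inter> {E. \<forall>p\<in>I. E p = E\<^sub>0 p} = {E. \<forall>p\<in>insert p I. E p = E\<^sub>0 p}" by blast
  ultimately show ?case by simp
qed (use openin_topspace[of rel_top] in simp)

definition words :: "nat \<Rightarrow> nat \<Rightarrow> (nat \<times> bool) list set" where
  "words n r = {w \<in> lists (letters n). length w \<le> r}"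

lemma finite_words: "finite (words n r)"
proof -
  have "words n r = {w. set w \<subseteq> letters n \<and> length w \<le> r}"
    by (auto simp: words_def lists_eq_set)
  moreover have "finite (letters n)" by (simp add: letters_def)
  ultimately show ?thesis using finite_lists_length_le by simp
qed

definition coset_class :: "nat \<Rightarrow> word_rel \<Rightarrow> rooted_schreier set" where
  "coset_class n E = La.cls n (coset_relation.coset_graph n E, coset_relation.coset n E [])"

lemma walk_coset_graph_eq_iff:
  assumes "E \<in> coset_relations n" "u \<in> lists (letters n)" "v \<in> lists (letters n)"
  shows "schreier_graph.walk (coset_relation.coset_graph n E) (coset_relation.coset n E []) u =
    schreier_graph.walk (coset_relation.coset_graph n E) (coset_relation.coset n E []) v \<longleftrightarrow> E (u, v)"
proof -
  interpret coset_relation n E by standard fact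
  show ?thesis using assms by (simp add: walk_coset coset_eq_iff)
qed

lemma nb_coset_graph_cong:
  assumes E: "E \<in> coset_relations n" "E' \<in> coset_relations n"
    and agree: "\<forall>p\<in>words n (Suc r) \<times> words n (Suc r). E' p = E p"
  shows "La.iso (La.nb r (coset_relation.coset_graph n E', coset_relation.coset n E' []))
    (La.nb r (coset_relation.coset_graph n E, coset_relation.coset n E []))"
proof -
  interpret E: coset_relation n E by standard fact
  interpret E': coset_relation n E' by standard fact
  have sub: "words n r \<union> (\<lambda>(u, a). u @ [a]) ` (words n r \<times> letters n) \<subseteq> words n (Suc r)"
    by (auto simp: words_def)
  have subL: "words n s \<subseteq> lists (letters n)" for s by (auto simp: words_def)
  have "La.iso (induced E'.coset_graph (E'.cg.walk (E'.coset []) ` words n r), E'.coset [])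
      (induced E.coset_graph (E.cg.walk (E.coset []) ` words n r), E.coset [])"
  proof (rule La_iso_if_same_coincidences[OF E'.coset_graph_in E.coset_graph_in subL])
    fix u v assume "u \<in> words n r \<union> (\<lambda>(u, a). u @ [a]) ` (words n r \<times> letters n)" "v \<in> words n r"
    then have uv: "u \<in> words n (Suc r)" "v \<in> words n (Suc r)" using sub by blast+
    then have "E' (u, v) = E (u, v)" using agree by blast
    then show "(E'.cg.walk (E'.coset []) u = E'.cg.walk (E'.coset []) v) =
        (E.cg.walk (E.coset []) u = E.cg.walk (E.coset []) v)"
      using walk_coset_graph_eq_iff[OF E(1)] walk_coset_graph_eq_iff[OF E(2)] uv subL by blast
  qed (simp add: words_def)
  then show ?thesis
    unfolding La.nb_def fst_conv snd_conv nbhd_eq_induced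
      E.cg.ball_eq_walks[OF E.root_in_coset_graph] E'.cg.ball_eq_walks[OF E'.root_in_coset_graph]
    by (simp add: words_def)
qed

text \<open>A Schreier graph is isomorphic to the coset graph of its own coincidence relation.\<close>

lemma coset_class_surj:
  assumes "A \<in> schreier_graphs n // La.rel n"
  shows "\<exists>E\<in>coset_relations n. coset_class n E = A"
proof -
  obtain G x where p: "(G, x) \<in> schreier_graphs n" "A = La.cls n (G, x)"
    using assms by (metis La.classes_cases surj_pair)
  interpret schreier_graph n G using schreier_graphsD(1)[OF p(1)] .
  define E where "E = (\<lambda>(u, v). walk x u = walk x v)"
  have E: "E \<in> coset_relations n"
    unfolding E_def using coincidences_in_coset_relations schreier_graphsD(3)[OF p(1)] .
  interpret E: coset_relation n E by standard fact
  have "La.iso (induced E.coset_graph (E.cg.walk (E.coset []) ` lists (letters n)), E.coset [])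
      (induced G (walk x ` lists (letters n)), x)"
  proof (rule La_iso_if_same_coincidences[OF E.coset_graph_in p(1) subset_refl])
    fix u v assume "u \<in> lists (letters n) \<union> (\<lambda>(u, a). u @ [a]) ` (lists (letters n) \<times> letters n)"
      "v \<in> lists (letters n)"
    then have uv: "u \<in> lists (letters n)" "v \<in> lists (letters n)" by auto
    have "E (u, v) = (walk x u = walk x v)" by (simp add: E_def)
    then show "(E.cg.walk (E.coset []) u = E.cg.walk (E.coset []) v) = (walk x u = walk x v)"
      using walk_coset_graph_eq_iff[OF E uv] by blast
  qed simp
  then have "La.iso (E.coset_graph, E.coset []) (G, x)"
    unfolding E.cg.verts_eq_walks[OF E.connected_coset_graph E.root_in_coset_graph, symmetric]
      verts_eq_walks[OF schreier_graphsD(2,3)[OF p(1)], symmetric] induced_verts[OF wf]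
      induced_verts[OF E.cg.wf] .
  then have "coset_class n E = A"
    unfolding coset_class_def p(2) using La.cls_eq_iff[OF E.coset_graph_in p(1)] by simp
  then show ?thesis using E by blast
qed

text \<open>The \<open>r\<close>-neighborhood of the root depends only on the restriction of the relation to the finitely many words of
length at most \<open>r + 1\<close>.\<close>

lemma continuous_coset_class:
  "continuous_map (subtopology rel_top (coset_relations n)) (La.cyl_top n) (coset_class n)"
  unfolding continuous_map_def
proof (intro conjI allI impI)
  have in_classes: "coset_class n E \<in> schreier_graphs n // La.rel n" if "E \<in> coset_relations n" for E
    unfolding coset_class_def using that coset_relation.coset_graph_in
    by (intro La.cls_in) (simp add: coset_relation_def)
  then show "coset_class n \<in> topspace (subtopology rel_top (coset_relations n)) \<rightarrow> topspace (La.cyl_top n)"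
    by (auto simp: La.topspace_cyl_top)
  fix S assume S: "openin (La.cyl_top n) S"
  let ?P = "{E \<in> topspace (subtopology rel_top (coset_relations n)). coset_class n E \<in> S}"
  show "openin (subtopology rel_top (coset_relations n)) ?P"
  proof (subst openin_subopen, intro ballI)
    fix E assume "E \<in> ?P"
    then have E: "E \<in> coset_relations n" "coset_class n E \<in> S" by auto
    interpret E: coset_relation n E by standard fact
    define p where "p = (E.coset_graph, E.coset [])"
    have p: "p \<in> schreier_graphs n" "coset_class n E = La.cls n p"
      by (simp_all add: p_def E.coset_graph_in coset_class_def)
    obtain r where r: "La.cyl n r (La.nb r p) \<subseteq> S"
      using S E(2) p unfolding La.openin_cyl_top_iff by metis
    define N where "N = {E'. \<forall>q\<in>words n (Suc r) \<times> words n (Suc r). E' q = E q}"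
    have "openin rel_top N" unfolding N_def by (rule openin_agreeing) (simp add: finite_words)
    then have "openin (subtopology rel_top (coset_relations n)) (coset_relations n \<inter> N)"
      by (rule openin_subtopology_Int2)
    moreover have "E \<in> coset_relations n \<inter> N" using E(1) by (simp add: N_def)
    moreover have "coset_relations n \<inter> N \<subseteq> ?P"
    proof
      fix E' assume E': "E' \<in> coset_relations n \<inter> N"
      interpret E': coset_relation n E' by standard (use E' in blast)
      have "La.iso (La.nb r (E'.coset_graph, E'.coset [])) (La.nb r p)"
        unfolding p_def using nb_coset_graph_cong[OF E(1) E'.E, of r] E' unfolding N_def by blast
      then have "coset_class n E' \<in> La.cyl n r (La.nb r p)"
        unfolding coset_class_def using La.cls_in_cyl[OF E'.coset_graph_in] by simp
      then show "E' \<in> ?P" using r E'.E by auto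
    qed
    ultimately show "\<exists>T. openin (subtopology rel_top (coset_relations n)) T \<and> E \<in> T \<and> T \<subseteq> ?P"
      by blast
  qed
qed

theorem compact_space_Lambda: "compact_space (La.cyl_top n)"
proof -
  have "compact_space rel_top"
    by (simp add: compact_space_product_topology compact_space_discrete_topology)
  then have "compactin rel_top (coset_relations n)"
    by (rule closedin_compact_space) (rule closedin_coset_relations)
  then have "compactin (subtopology rel_top (coset_relations n)) (coset_relations n)"
    by (simp add: compactin_subtopology)
  then have "compactin (La.cyl_top n) (coset_class n ` coset_relations n)"
    using continuous_coset_class by (rule image_compactin)
  moreover have "coset_class n ` coset_relations n = topspace (La.cyl_top n)"
  proof
    show "coset_class n ` coset_relations n \<subseteq> topspace (La.cyl_top n)"
      using calculation by (rule compactin_subset_topspace)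
    show "topspace (La.cyl_top n) \<subseteq> coset_class n ` coset_relations n"
      unfolding La.topspace_cyl_top using coset_class_surj by blast
  qed
  ultimately show ?thesis by (simp add: compact_space_def)
qed

section \<open>The forgetful map\<close>

lemma truncate_simps [simp]:
  "verts (multigraph.truncate G) = verts G" "edges (multigraph.truncate G) = edges G"
  "ends (multigraph.truncate G) = ends G"
  by (simp_all add: multigraph.truncate_def)

lemma truncate_induced: "multigraph.truncate (induced G W) = induced (multigraph.truncate G) W"
  by (simp add: induced_def multigraph.truncate_def)

lemma adj_truncate [simp]: "adj (multigraph.truncate G) = adj G"
  by (simp add: adj_def)

lemma truncate_nbhd: "multigraph.truncate (nbhd G x r) = nbhd (multigraph.truncate G) x r"
  by (simp add: nbhd_def truncate_induced)

lemma truncate_component: "multigraph.truncate (component G x) = component (multigraph.truncate G) x"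
  by (simp add: component_def truncate_induced)

lemma wf_truncate: "wf_multigraph (multigraph.truncate G) \<longleftrightarrow> wf_multigraph G"
  by (simp add: wf_multigraph_def)

lemma regular_truncate: "regular d (multigraph.truncate G) \<longleftrightarrow> regular d G"
  by (simp add: regular_def degree_def)

lemma connected_truncate: "connected_graph (multigraph.truncate G) \<longleftrightarrow> connected_graph G"
  by (simp add: connected_graph_def)

lemma finite_regular_truncate:
  "finite_regular_graph n (multigraph.truncate G) \<longleftrightarrow> finite_regular_graph n G"
  by (simp add: finite_regular_graph_def wf_truncate regular_truncate)

definition forget_rep :: "rooted_schreier \<Rightarrow> rooted_graph" where
  "forget_rep p = (multigraph.truncate (fst p), snd p)"

lemma forget_rep_in: "p \<in> schreier_graphs n \<Longrightarrow> forget_rep p \<in> rooted_graphs n"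
  by (auto simp: schreier_graphs_def rooted_graphs_def forget_rep_def wf_truncate regular_truncate
      connected_truncate)

lemma iso_forget_rep: "La.iso p q \<Longrightarrow> Om.iso (forget_rep p) (forget_rep q)"
proof -
  assume "La.iso p q"
  then obtain \<phi> \<psi> where "graph_iso \<phi> \<psi> (fst p) (fst q)" "\<phi> (snd p) = snd q"
    unfolding La.iso_def by blast
  then have "graph_iso \<phi> \<psi> (fst (forget_rep p)) (fst (forget_rep q))"
    "\<phi> (snd (forget_rep p)) = snd (forget_rep q)"
    by (simp_all add: forget_rep_def graph_iso_def)
  then show "Om.iso (forget_rep p) (forget_rep q)"
    unfolding Om.iso_def by (intro exI[of _ \<phi>] exI[of _ \<psi>]) (simp add: Om.dec_preserving_def)
qed

lemma nb_forget_rep: "Om.nb r (forget_rep p) = forget_rep (La.nb r p)"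
  by (simp add: Om.nb_def La.nb_def forget_rep_def truncate_nbhd)

lemma forget_cls:
  assumes p: "p \<in> schreier_graphs n"
  shows "forget n (La.cls n p) = Om.cls n (forget_rep p)"
proof -
  have "Omega_rel n `` {(multigraph.truncate G, x)} = Om.cls n (forget_rep p)"
    if "(G, x) \<in> La.cls n p" for G x
  proof -
    have q: "(G, x) \<in> schreier_graphs n" "La.iso p (G, x)" using that by (simp_all add: La.mem_cls)
    then have "Om.iso (forget_rep p) (forget_rep (G, x))" by (intro iso_forget_rep)
    then have "Om.cls n (forget_rep p) = Om.cls n (forget_rep (G, x))"
      using Om.cls_eq_iff forget_rep_in p q(1) by blast
    then show ?thesis by (simp add: Om.cls_def Omega_rel_eq forget_rep_def)
  qed
  then have "(case q of (G, x) \<Rightarrow> Omega_rel n `` {(multigraph.truncate G, x)}) = Om.cls n (forget_rep p)"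
    if "q \<in> La.cls n p" for q
    using that by (cases q) (simp only: prod.case)
  moreover have "p \<in> La.cls n p" using p by (simp add: La.mem_cls La.iso_refl)
  ultimately show ?thesis unfolding forget_def by (intro UN_constant_eq ballI)
qed

text \<open>Isomorphic labeled neighborhoods are also isomorphic after the labels are forgotten.\<close>

theorem continuous_forget: "continuous_map (La.cyl_top n) (Om.cyl_top n) (forget n)"
  unfolding continuous_map_def
proof (intro conjI allI impI)
  show "forget n \<in> topspace (La.cyl_top n) \<rightarrow> topspace (Om.cyl_top n)"
  proof
    fix A assume "A \<in> topspace (La.cyl_top n)"
    then obtain p where p: "p \<in> schreier_graphs n" "A = La.cls n p"
      unfolding La.topspace_cyl_top by (rule La.classes_cases)
    then show "forget n A \<in> topspace (Om.cyl_top n)"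
      unfolding Om.topspace_cyl_top using forget_cls[OF p(1)] Om.cls_in[OF forget_rep_in[OF p(1)]] by simp
  qed
  fix S assume S: "openin (Om.cyl_top n) S"
  show "openin (La.cyl_top n) {A \<in> topspace (La.cyl_top n). forget n A \<in> S}"
    unfolding La.openin_cyl_top_iff La.topspace_cyl_top
  proof (intro conjI ballI impI)
    fix p assume p: "p \<in> schreier_graphs n"
      and "La.cls n p \<in> {A \<in> schreier_graphs n // La.rel n. forget n A \<in> S}"
    then have "Om.cls n (forget_rep p) \<in> S" using forget_cls[OF p] by simp
    then obtain r where r: "Om.cyl n r (Om.nb r (forget_rep p)) \<subseteq> S"
      using S forget_rep_in[OF p] unfolding Om.openin_cyl_top_iff by blast
    have "La.cyl n r (La.nb r p) \<subseteq> {A \<in> schreier_graphs n // La.rel n. forget n A \<in> S}"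
    proof
      fix A assume A: "A \<in> La.cyl n r (La.nb r p)"
      then have AQ: "A \<in> schreier_graphs n // La.rel n" using La.cyl_subset by blast
      then obtain q where q: "q \<in> schreier_graphs n" "A = La.cls n q" by (rule La.classes_cases)
      have "La.iso (La.nb r q) (La.nb r p)" using A q La.cls_in_cyl by simp
      then have "Om.iso (Om.nb r (forget_rep q)) (Om.nb r (forget_rep p))"
        unfolding nb_forget_rep by (rule iso_forget_rep)
      then have "Om.cls n (forget_rep q) \<in> Om.cyl n r (Om.nb r (forget_rep p))"
        using Om.cls_in_cyl[OF forget_rep_in[OF q(1)]] by simp
      then have "forget n A \<in> S" using r forget_cls[OF q(1)] q(2) by auto
      then show "A \<in> {A \<in> schreier_graphs n // La.rel n. forget n A \<in> S}" using AQ by blast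
    qed
    then show "\<exists>r. La.cyl n r (La.nb r p) \<subseteq> {A \<in> schreier_graphs n // La.rel n. forget n A \<in> S}" ..
  qed blast
qed

lemma forget_measurable:
  "forget n \<in> measurable (borel_of_top (La.cyl_top n)) (borel_of_top (Om.cyl_top n))"
proof (rule measurable_sigma_sets[OF Om.sets_borel])
  show "{S. openin (Om.cyl_top n) S} \<subseteq> Pow (topspace (Om.cyl_top n))"
    using openin_subset by blast
  show "forget n \<in> space (borel_of_top (La.cyl_top n)) \<rightarrow> topspace (Om.cyl_top n)"
    using continuous_forget unfolding La.space_borel continuous_map_def by blast
  fix S assume "S \<in> {S. openin (Om.cyl_top n) S}"
  then have "openin (La.cyl_top n) {A \<in> topspace (La.cyl_top n). forget n A \<in> S}"
    using continuous_forget unfolding continuous_map_def by blast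
  moreover have "forget n -` S \<inter> space (borel_of_top (La.cyl_top n)) =
      {A \<in> topspace (La.cyl_top n). forget n A \<in> S}"
    by (auto simp: La.space_borel)
  ultimately show "forget n -` S \<inter> space (borel_of_top (La.cyl_top n)) \<in> sets (borel_of_top (La.cyl_top n))"
    by (auto simp: La.sets_borel)
qed

lemma forget_push_prob:
  assumes "prob_space \<nu>" "sets \<nu> = sets (borel_of_top (La.cyl_top n))"
  shows "prob_space (forget_push n \<nu>)" "sets (forget_push n \<nu>) = sets (borel_of_top (Om.cyl_top n))"
proof -
  have "forget n \<in> measurable \<nu> (borel_of_top (Om.cyl_top n))"
    using forget_measurable measurable_cong_sets[OF assms(2) refl] by blast
  then show "prob_space (forget_push n \<nu>)"
    unfolding forget_push_def Omega_top_eq by (rule prob_space.prob_space_distr[OF assms(1)])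
  show "sets (forget_push n \<nu>) = sets (borel_of_top (Om.cyl_top n))"
    by (simp add: forget_push_def Omega_top_eq)
qed

lemma converges_weakly_forget_push:
  assumes conv: "converges_weakly (La.cyl_top n) P \<nu>"
    and P: "\<And>i. sets (P i) = sets (borel_of_top (La.cyl_top n))"
    and \<nu>: "sets \<nu> = sets (borel_of_top (La.cyl_top n))"
  shows "converges_weakly (Om.cyl_top n) (\<lambda>i. forget_push n (P i)) (forget_push n \<nu>)"
  unfolding converges_weakly_def
proof (intro allI impI)
  fix g assume g: "continuous_map (Om.cyl_top n) euclideanreal g \<and> bounded (g ` topspace (Om.cyl_top n))"
  then have g: "continuous_map (Om.cyl_top n) euclideanreal g" "bounded (g ` topspace (Om.cyl_top n))"
    by simp_all
  have "continuous_map (La.cyl_top n) euclideanreal (g \<circ> forget n)"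
    using continuous_forget g(1) by (rule continuous_map_compose)
  moreover have "(g \<circ> forget n) ` topspace (La.cyl_top n) \<subseteq> g ` topspace (Om.cyl_top n)"
    using continuous_forget[of n] by (auto simp: continuous_map_def)
  then have "bounded ((g \<circ> forget n) ` topspace (La.cyl_top n))"
    by (rule bounded_subset[OF g(2)])
  ultimately have "(\<lambda>i. \<integral>x. (g \<circ> forget n) x \<partial>P i) \<longlonglongrightarrow> (\<integral>x. (g \<circ> forget n) x \<partial>\<nu>)"
    using conv unfolding converges_weakly_def by blast
  moreover have "(\<integral>x. g x \<partial>forget_push n M) = (\<integral>x. (g \<circ> forget n) x \<partial>M)"
    if M: "sets M = sets (borel_of_top (La.cyl_top n))" for M
  proof -
    have "forget n \<in> measurable M (borel_of_top (Om.cyl_top n))"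
      using forget_measurable measurable_cong_sets[OF M refl] by blast
    moreover have "g \<in> borel_measurable (borel_of_top (Om.cyl_top n))"
      using g(1) refl by (rule Om.continuous_imp_borel_measurable)
    ultimately show ?thesis
      unfolding forget_push_def Omega_top_eq by (simp add: integral_distr)
  qed
  ultimately show "(\<lambda>i. \<integral>x. g x \<partial>forget_push n (P i)) \<longlonglongrightarrow> (\<integral>x. g x \<partial>forget_push n \<nu>)"
    using P \<nu> by simp
qed

section \<open>Random rootings of finite graphs\<close>

lemma component_verts: "verts (component G x) = {y \<in> verts G. (x, y) \<in> (adj G)\<^sup>*}"
  by (simp add: component_def)

lemma sym_adj: "sym (adj G)"
  by (auto simp: sym_def adj_def insert_commute)

lemma component_edge_subset:
  assumes wf: "wf_multigraph G" and e: "e \<in> edges G" and v: "v \<in> ends G e"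
    and vC: "v \<in> verts (component G x)"
  shows "ends G e \<subseteq> verts (component G x)"
proof
  fix w assume w: "w \<in> ends G e"
  obtain a b where ab: "a \<in> verts G" "b \<in> verts G" "ends G e = {a, b}"
    using wf e by (auto simp: wf_multigraph_def)
  have "(v, w) \<in> (adj G)\<^sup>*"
  proof (cases "v = w")
    case False
    then have "ends G e = {v, w}" using ab(3) v w by auto
    then have "(v, w) \<in> adj G" using e by (auto simp: adj_def)
    then show ?thesis by blast
  qed simp
  moreover have "w \<in> verts G" using w ab by auto
  ultimately show "w \<in> verts (component G x)"
    using vC by (auto simp: component_verts intro: rtrancl_trans)
qed

lemma component_incident:
  assumes "wf_multigraph G" "v \<in> verts (component G x)"
  shows "{e \<in> edges (component G x). v \<in> ends (component G x) e} = {e \<in> edges G. v \<in> ends G e}"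
proof -
  have "ends G e \<subseteq> verts (component G x)" if "e \<in> edges G" "v \<in> ends G e" for e
    using component_edge_subset[OF assms(1) that assms(2)] .
  then show ?thesis by (auto simp: component_def)
qed

lemma component_loops:
  assumes "wf_multigraph G" "v \<in> verts (component G x)"
  shows "{e \<in> edges (component G x). ends (component G x) e = {v}} = {e \<in> edges G. ends G e = {v}}"
  using assms(2) by (auto simp: component_def)

lemma regular_component:
  assumes wf: "wf_multigraph G" and reg: "regular d G"
  shows "regular d (component G x)"
  unfolding regular_def
proof
  fix v assume v: "v \<in> verts (component G x)"
  then have "v \<in> verts G" by (simp add: component_verts)
  then show "finite {e \<in> edges (component G x). v \<in> ends (component G x) e} \<and> degree (component G x) v = d"
    using reg unfolding regular_def degree_def component_incident[OF wf v] component_loops[OF wf v]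
    by blast
qed

lemma connected_component_graph:
  assumes wf: "wf_multigraph G"
  shows "connected_graph (component G x)"
  unfolding connected_graph_def
proof (intro ballI)
  let ?C = "component G x"
  have reach: "(x, y) \<in> (adj ?C)\<^sup>*" if "(x, y) \<in> (adj G)\<^sup>*" "y \<in> verts G" for y
    using that
  proof (induction rule: rtrancl_induct)
    case (step y z)
    have y: "y \<in> verts G" using adj_verts[OF wf step.hyps(2)] by blast
    have "(x, z) \<in> (adj G)\<^sup>*" using step.hyps by (rule rtrancl_into_rtrancl)
    then have "(y, z) \<in> adj ?C"
      using step.hyps step.prems y by (simp add: component_def adj_induced)
    then show ?case using step.IH[OF y] by (rule rtrancl_into_rtrancl[rotated])
  qed simp
  have sym: "sym ((adj ?C)\<^sup>*)" using sym_adj by (rule sym_rtrancl)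
  fix y z assume "y \<in> verts ?C" "z \<in> verts ?C"
  then have "(x, y) \<in> (adj ?C)\<^sup>*" "(x, z) \<in> (adj ?C)\<^sup>*" by (simp_all add: component_verts reach)
  then show "(y, z) \<in> (adj ?C)\<^sup>*" using symD[OF sym] by (meson rtrancl_trans)
qed

lemma schreier_structure_component:
  assumes wf: "wf_multigraph G" and S: "schreier_structure n G"
  shows "schreier_structure n (component G x)"
proof -
  interpret schreier_graph n G using wf S by unfold_locales
  let ?C = "component G x"
  have fields: "source ?C = source G" "target ?C = target G" "gen ?C = gen G" "ends ?C = ends G"
    by (simp_all add: component_def induced_def)
  have sub: "e \<in> edges ?C \<Longrightarrow> e \<in> edges G" for e by (simp add: component_def)
  have sup: "e \<in> edges ?C" if "e \<in> edges G" "v \<in> ends G e" "v \<in> verts ?C" for e v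
    using that component_edge_subset[OF wf that] by (simp add: component_def)
  have V: "v \<in> verts G" if "v \<in> verts ?C" for v using that by (simp add: component_verts)
  have incoming: "\<exists>!e. e \<in> edges ?C \<and> gen G e = i \<and> target G e = v"
    if v: "v \<in> verts ?C" and i: "i \<in> {1..n}" for v i
  proof (rule ex1I[of _ "in_edge v i"])
    show "in_edge v i \<in> edges ?C \<and> gen G (in_edge v i) = i \<and> target G (in_edge v i) = v"
    proof -
      note e = in_edge[OF V[OF v] i]
      have "v \<in> ends G (in_edge v i)" using ends_eq[OF e(1)] e(3) by simp
      then have "in_edge v i \<in> edges ?C" using v by (rule sup[OF e(1)])
      then show ?thesis using e(2,3) by blast
    qed
    show "e = in_edge v i" if "e \<in> edges ?C \<and> gen G e = i \<and> target G e = v" for e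
    proof -
      have "in_edge (target G e) (gen G e) = e" using that sub by (intro in_edge_eqI) blast
      then show ?thesis using that by metis
    qed
  qed
  have outgoing: "\<exists>!e. e \<in> edges ?C \<and> gen G e = i \<and> source G e = v"
    if v: "v \<in> verts ?C" and i: "i \<in> {1..n}" for v i
  proof (rule ex1I[of _ "out_edge v i"])
    show "out_edge v i \<in> edges ?C \<and> gen G (out_edge v i) = i \<and> source G (out_edge v i) = v"
    proof -
      note e = out_edge[OF V[OF v] i]
      have "v \<in> ends G (out_edge v i)" using ends_eq[OF e(1)] e(3) by simp
      then have "out_edge v i \<in> edges ?C" using v by (rule sup[OF e(1)])
      then show ?thesis using e(2,3) by blast
    qed
    show "e = out_edge v i" if "e \<in> edges ?C \<and> gen G e = i \<and> source G e = v" for e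
    proof -
      have "out_edge (source G e) (gen G e) = e" using that sub by (intro out_edge_eqI) blast
      then show ?thesis using that by metis
    qed
  qed
  show ?thesis
    unfolding schreier_structure_def fields
    by (intro conjI ballI incoming outgoing ends_eq[OF sub] gen_range[OF sub])
qed

lemma component_in_schreier_graphs:
  assumes "finite_regular_graph n G" "schreier_structure n G" "x \<in> verts G"
  shows "(component G x, x) \<in> schreier_graphs n"
proof -
  have wf: "wf_multigraph G" and reg: "regular (2 * n) G"
    using assms(1) by (simp_all add: finite_regular_graph_def)
  have "wf_multigraph (component G x)" unfolding component_def by (rule wf_induced[OF wf])
  then show ?thesis
    using regular_component[OF wf reg] connected_component_graph[OF wf] assms(3)
      schreier_structure_component[OF wf assms(2)]
    by (simp add: schreier_graphs_def component_verts)
qed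

lemma Lambda_measure_eq:
  "Lambda_measure n G = distr (uniform_count_measure (verts G)) (borel_of_top (La.cyl_top n))
     (\<lambda>x. La.cls n (component G x, x))"
  by (simp add: Lambda_measure_def Lambda_top_eq Lambda_rel_eq La.cls_def)

lemma Lambda_measure_measurable:
  assumes "finite_regular_graph n G" "schreier_structure n G"
  shows "(\<lambda>x. La.cls n (component G x, x)) \<in>
    measurable (uniform_count_measure (verts G)) (borel_of_top (La.cyl_top n))"
proof -
  have "La.cls n (component G x, x) \<in> topspace (La.cyl_top n)" if "x \<in> verts G" for x
    unfolding La.topspace_cyl_top by (rule La.cls_in[OF component_in_schreier_graphs[OF assms that]])
  then show ?thesis
    by (auto simp: measurable_def space_uniform_count_measure sets_uniform_count_measure La.space_borel)
qed

lemma Lambda_measure_prob: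
  assumes "finite_regular_graph n G" "schreier_structure n G"
  shows "prob_space (Lambda_measure n G)"
    "sets (Lambda_measure n G) = sets (borel_of_top (La.cyl_top n))"
proof -
  have "prob_space (uniform_count_measure (verts G))"
    using assms(1) by (intro prob_space_uniform_count_measure) (simp_all add: finite_regular_graph_def)
  then show "prob_space (Lambda_measure n G)"
    unfolding Lambda_measure_eq
    by (rule prob_space.prob_space_distr) (rule Lambda_measure_measurable[OF assms])
qed (simp add: Lambda_measure_eq)

text \<open>Forgetting the labels commutes with taking the component of a random root.\<close>

lemma forget_push_Lambda_measure:
  assumes G: "finite_regular_graph n G" "schreier_structure n G"
  shows "forget_push n (Lambda_measure n G) = Omega_measure n (multigraph.truncate G)"
proof -
  have "forget_push n (Lambda_measure n G) =
      distr (uniform_count_measure (verts G)) (borel_of_top (Om.cyl_top n))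
        (forget n \<circ> (\<lambda>x. La.cls n (component G x, x)))"
    unfolding forget_push_def Lambda_measure_eq Omega_top_eq
    by (rule distr_distr[OF forget_measurable Lambda_measure_measurable[OF G]])
  also have "\<dots> = Omega_measure n (multigraph.truncate G)"
    unfolding Omega_measure_def Omega_top_eq truncate_simps
  proof (rule distr_cong)
    fix x assume "x \<in> space (uniform_count_measure (verts G))"
    then have x: "x \<in> verts G" by (simp add: space_uniform_count_measure)
    show "(forget n \<circ> (\<lambda>x. La.cls n (component G x, x))) x =
        Omega_rel n `` {(component (multigraph.truncate G) x, x)}"
      using forget_cls[OF component_in_schreier_graphs[OF G x]]
      by (simp add: Om.cls_def Omega_rel_eq forget_rep_def truncate_component)
  qed simp_all
  finally show ?thesis .
qed

section \<open>Lifting sofic measures\<close>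

lemma converges_weakly_subseq:
  assumes conv: "converges_weakly T P N" and s: "strict_mono s"
  shows "converges_weakly T (P \<circ> s) N"
  unfolding converges_weakly_def
proof (intro allI impI)
  fix g assume "continuous_map T euclideanreal g \<and> bounded (g ` topspace T)"
  then have "(\<lambda>i. \<integral>x. g x \<partial>P i) \<longlonglongrightarrow> (\<integral>x. g x \<partial>N)"
    using conv unfolding converges_weakly_def by blast
  from LIMSEQ_subseq_LIMSEQ[OF this s]
  show "(\<lambda>i. \<integral>x. g x \<partial>(P \<circ> s) i) \<longlonglongrightarrow> (\<integral>x. g x \<partial>N)"
    by (simp add: comp_def)
qed

text \<open>The same finite graphs, with their labels forgotten, witness that the image is sofic.\<close>

lemma forget_push_sofic:
  assumes "\<nu> \<in> sofic_Lambda n"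
  shows "forget_push n \<nu> \<in> sofic_Omega n"
proof -
  obtain \<Gamma> where \<nu>: "sets \<nu> = sets (borel_of_top (La.cyl_top n))" "prob_space \<nu>"
    and \<Gamma>: "\<And>i. finite_regular_graph n (\<Gamma> i)" "\<And>i. schreier_structure n (\<Gamma> i)"
    and conv: "converges_weakly (La.cyl_top n) (\<lambda>i. Lambda_measure n (\<Gamma> i)) \<nu>"
    using assms unfolding sofic_Lambda_def Lambda_top_eq by blast
  have lim: "converges_weakly (Om.cyl_top n) (\<lambda>i. Omega_measure n (multigraph.truncate (\<Gamma> i))) (forget_push n \<nu>)"
    using converges_weakly_forget_push[OF conv Lambda_measure_prob(2)[OF \<Gamma>] \<nu>(1)]
    by (simp add: forget_push_Lambda_measure[OF \<Gamma>])
  have fin: "finite_regular_graph n (multigraph.truncate (\<Gamma> i))" for i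
    using \<Gamma>(1) by (simp add: finite_regular_truncate)
  show ?thesis
    unfolding sofic_Omega_def Omega_top_eq
    by (intro CollectI conjI forget_push_prob[OF \<nu>(2,1)] exI[of _ "\<lambda>i. multigraph.truncate (\<Gamma> i)"]
        allI fin lim)
qed

text \<open>The finite graphs approximating \<open>\<mu>\<close> are labeled arbitrarily. The lifted measures need not converge, but by
compactness a subsequence does, and its limit is mapped to \<open>\<mu>\<close> by continuity of the
forgetful map and uniqueness of weak limits.\<close>

lemma sofic_Omega_lift:
  assumes "\<mu> \<in> sofic_Omega n"
  shows "\<exists>\<nu>\<in>sofic_Lambda n. forget_push n \<nu> = \<mu>"
proof -
  obtain \<Gamma> where \<mu>: "sets \<mu> = sets (borel_of_top (Om.cyl_top n))" "prob_space \<mu>"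
    and \<Gamma>: "\<And>i. finite_regular_graph n (\<Gamma> i)"
    and conv: "converges_weakly (Om.cyl_top n) (\<lambda>i. Omega_measure n (\<Gamma> i)) \<mu>"
    using assms unfolding sofic_Omega_def Omega_top_eq by blast
  have "\<exists>H. multigraph.truncate H = \<Gamma> i \<and> schreier_structure n H" for i
    using \<Gamma>[of i] by (intro finite_regular_graph_has_schreier_structure)
      (simp_all add: finite_regular_graph_def)
  then obtain \<Delta> where \<Delta>: "\<And>i. multigraph.truncate (\<Delta> i) = \<Gamma> i" "\<And>i. schreier_structure n (\<Delta> i)"
    by metis
  have \<Delta>_fin: "finite_regular_graph n (\<Delta> i)" for i
    using \<Gamma>[of i] \<Delta>(1)[of i] finite_regular_truncate by metis
  note P = Lambda_measure_prob[OF \<Delta>_fin \<Delta>(2)]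
  obtain s \<nu> where s: "strict_mono s" and \<nu>: "prob_space \<nu>" "sets \<nu> = sets (borel_of_top (La.cyl_top n))"
    and lim: "converges_weakly (La.cyl_top n) ((\<lambda>i. Lambda_measure n (\<Delta> i)) \<circ> s) \<nu>"
    using La.weakly_convergent_subsequence[OF compact_space_Lambda, of "\<lambda>i. Lambda_measure n (\<Delta> i)"] P
    by blast
  have lim': "converges_weakly (La.cyl_top n) (\<lambda>i. Lambda_measure n (\<Delta> (s i))) \<nu>"
    using lim by (simp add: comp_def)
  have "\<nu> \<in> sofic_Lambda n"
    unfolding sofic_Lambda_def Lambda_top_eq using \<nu> lim' \<Delta>_fin \<Delta>(2)
    by (auto intro!: exI[of _ "\<lambda>i. \<Delta> (s i)"])
  moreover have "forget_push n \<nu> = \<mu>"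
  proof (rule Om.weak_limit_unique[OF forget_push_prob[OF \<nu>] \<mu>(2,1)])
    have "converges_weakly (Om.cyl_top n) (\<lambda>i. forget_push n (Lambda_measure n (\<Delta> (s i)))) (forget_push n \<nu>)"
      by (rule converges_weakly_forget_push[OF lim' P(2) \<nu>(2)])
    then show "converges_weakly (Om.cyl_top n) (\<lambda>i. Omega_measure n (\<Gamma> (s i))) (forget_push n \<nu>)"
      by (simp add: forget_push_Lambda_measure[OF \<Delta>_fin \<Delta>(2)] \<Delta>(1))
    show "converges_weakly (Om.cyl_top n) (\<lambda>i. Omega_measure n (\<Gamma> (s i))) \<mu>"
      using converges_weakly_subseq[OF conv s] by (simp add: comp_def)
  qed
  ultimately show ?thesis by blast
qed

theorem proposition6p1:
  fixes n :: nat
  shows "forget_push n ` sofic_Lambda n = sofic_Omega n"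
  using forget_push_sofic sofic_Omega_lift by blast

end
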